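(* Any free group $\Gamma$ of rank $n\ge 4$ can be written as an HNN-extension $\Gamma=\langle H,t\mid u^t=v\rangle$ (with $u,v\in H$) such that $H$ has a proper subgroup $A$ with $acl(A)=H$ and $dcl(A)=A$.
   Context: Here $n$ is a natural number (finite rank) and $u^t=t^{-1}ut$. The closures are computed in $\Gamma$, a structure in the first-order language $\{\cdot,{}^{-1},1\}$: $acl(A)$ (respectively $dcl(A)$) is the set of $g\in\Gamma$ for which there is a first-order formula $\varphi(x)$ with parameters from $A$ such that $\Gamma\models\varphi(g)$ and $\{c\in\Gamma:\Gamma\models\varphi(c)\}$ is finite (respectively, is a singleton). *)

theory Defs
  imports "HOL-Algebra.Generated_Groups"
begin

section \<open>Groups given by generators and relators\<close>

text \<open>A letter \<open>(True, x)\<close> stands for the generator \<open>x\<close>, a letter \<open>(False, x)\<close> for its formal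
  inverse.\<close>

type_synonym 'x word = "(bool \<times> 'x) list"

definition words :: "'x set \<Rightarrow> 'x word set" where
  "words X = lists (UNIV \<times> X)"

inductive_set pres_rel :: "'x set \<Rightarrow> 'x word set \<Rightarrow> ('x word \<times> 'x word) set"
  for X :: "'x set" and R :: "'x word set" where
  refl: "p \<in> words X \<Longrightarrow> (p, p) \<in> pres_rel X R"
| sym: "(p, q) \<in> pres_rel X R \<Longrightarrow> (q, p) \<in> pres_rel X R"
| trans: "(p, q) \<in> pres_rel X R \<Longrightarrow> (q, r) \<in> pres_rel X R \<Longrightarrow> (p, r) \<in> pres_rel X R"
| cancel: "p \<in> words X \<Longrightarrow> q \<in> words X \<Longrightarrow> x \<in> X \<Longrightarrow>
    (p @ [(b, x), (\<not> b, x)] @ q, p @ q) \<in> pres_rel X R"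
| relator: "p \<in> words X \<Longrightarrow> q \<in> words X \<Longrightarrow> r \<in> R \<Longrightarrow> (p @ r @ q, p @ q) \<in> pres_rel X R"

definition word_class :: "'x set \<Rightarrow> 'x word set \<Rightarrow> 'x word \<Rightarrow> 'x word set" where
  "word_class X R w = pres_rel X R `` {w}"

text \<open>The group \<open>\<langle>X | R\<rangle>\<close>, for \<open>R \<subseteq> words X\<close>.\<close>

definition presented_group :: "'x set \<Rightarrow> 'x word set \<Rightarrow> 'x word set monoid" where
  "presented_group X R =
    \<lparr>carrier = words X // pres_rel X R,
     mult = (\<lambda>P Q. \<Union>p\<in>P. \<Union>q\<in>Q. word_class X R (p @ q)),
     one = word_class X R []\<rparr>"

definition free_group :: "'x set \<Rightarrow> 'x word set monoid" where
  "free_group X = presented_group X {}"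

definition free_of_rank :: "('a, 'b) monoid_scheme \<Rightarrow> nat \<Rightarrow> bool" where
  "free_of_rank G n \<longleftrightarrow> group G \<and> G \<cong> free_group {..<n}"

lemma words_simps [simp]:
  "[] \<in> words X"
  "a # p \<in> words X \<longleftrightarrow> snd a \<in> X \<and> p \<in> words X"
  "p @ q \<in> words X \<longleftrightarrow> p \<in> words X \<and> q \<in> words X"
  by (auto simp: words_def mem_Times_iff)

lemma pres_rel_words:
  assumes "R \<subseteq> words X" and "(p, q) \<in> pres_rel X R"
  shows "p \<in> words X \<and> q \<in> words X"
  using assms(2,1) by (induction rule: pres_rel.induct) auto

lemma equiv_pres_rel:
  assumes "R \<subseteq> words X"
  shows "equiv (words X) (pres_rel X R)"
proof (rule equivI)
  show "pres_rel X R \<subseteq> words X \<times> words X"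
    using pres_rel_words[OF assms] by auto
  show "refl_on (words X) (pres_rel X R)"
    by (auto simp: refl_on_def intro: pres_rel.refl)
  show "sym (pres_rel X R)"
    by (meson symI pres_rel.sym)
  show "trans (pres_rel X R)"
    by (meson transI pres_rel.trans)
qed

lemma pres_rel_append_left:
  assumes "(p, q) \<in> pres_rel X R" and "s \<in> words X"
  shows "(s @ p, s @ q) \<in> pres_rel X R"
  using assms
proof (induction rule: pres_rel.induct)
  case (cancel p q x b)
  then show ?case using pres_rel.cancel[of "s @ p" X q x b R] by simp
next
  case (relator p q r)
  then show ?case using pres_rel.relator[of "s @ p" X q r R] by simp
qed (auto intro: pres_rel.intros)

lemma pres_rel_append_right:
  assumes "(p, q) \<in> pres_rel X R" and "s \<in> words X"
  shows "(p @ s, q @ s) \<in> pres_rel X R"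
  using assms
proof (induction rule: pres_rel.induct)
  case (cancel p q x b)
  then show ?case using pres_rel.cancel[of p X "q @ s" x b R] by simp
next
  case (relator p q r)
  then show ?case using pres_rel.relator[of p X "q @ s" r R] by simp
qed (auto intro: pres_rel.intros)

lemma word_class_eq_iff:
  assumes "R \<subseteq> words X" and "p \<in> words X" and "q \<in> words X"
  shows "word_class X R p = word_class X R q \<longleftrightarrow> (p, q) \<in> pres_rel X R"
  using eq_equiv_class_iff[OF equiv_pres_rel[OF assms(1)] assms(2,3)]
  by (simp add: word_class_def)

lemma carrier_presented_group:
  "carrier (presented_group X R) = word_class X R ` words X"
  by (auto simp: presented_group_def word_class_def quotient_def)

lemma one_presented_group: "\<one>\<^bsub>presented_group X R\<^esub> = word_class X R []"
  by (simp add: presented_group_def)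

lemma mult_presented_group:
  assumes R: "R \<subseteq> words X" and "p \<in> words X" and "q \<in> words X"
  shows "word_class X R p \<otimes>\<^bsub>presented_group X R\<^esub> word_class X R q = word_class X R (p @ q)"
proof -
  have "word_class X R (p' @ q') = word_class X R (p @ q)"
    if "(p, p') \<in> pres_rel X R" "(q, q') \<in> pres_rel X R" for p' q'
  proof -
    have w: "p' \<in> words X" "q' \<in> words X"
      using that pres_rel_words[OF R] by auto
    have "(p @ q, p' @ q') \<in> pres_rel X R"
      using that assms(2,3) w
      by (meson pres_rel.trans pres_rel_append_left pres_rel_append_right)
    then show ?thesis
      using w assms by (simp add: word_class_eq_iff pres_rel.sym)
  qed
  moreover have "(p, p) \<in> pres_rel X R" "(q, q) \<in> pres_rel X R"
    using assms by (auto intro: pres_rel.refl)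
  ultimately have "(\<Union>p'\<in>word_class X R p. \<Union>q'\<in>word_class X R q. word_class X R (p' @ q'))
      = word_class X R (p @ q)"
    unfolding word_class_def[of X R p] word_class_def[of X R q] by blast
  then show ?thesis
    by (simp add: presented_group_def)
qed

lemma word_inverse_cancel:
  assumes "p \<in> words X"
  shows "(rev (map (\<lambda>(b, x). (\<not> b, x)) p) @ p, []) \<in> pres_rel X R
    \<and> rev (map (\<lambda>(b, x). (\<not> b, x)) p) \<in> words X"
  using assms
proof (induction p)
  case Nil
  then show ?case by (auto intro: pres_rel.refl)
next
  case (Cons a p)
  obtain b x where a: "a = (b, x)" by (cases a)
  let ?q = "rev (map (\<lambda>(b, x). (\<not> b, x)) p)"
  have "(?q @ [(\<not> b, x), (\<not> \<not> b, x)] @ p, ?q @ p) \<in> pres_rel X R"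
    using Cons a by (intro pres_rel.cancel) auto
  then show ?case
    using Cons a by (auto intro: pres_rel.trans)
qed

theorem group_presented_group:
  assumes R: "R \<subseteq> words X"
  shows "group (presented_group X R)"
proof (rule groupI)
  fix P assume "P \<in> carrier (presented_group X R)"
  then obtain p where p: "p \<in> words X" "P = word_class X R p"
    by (auto simp: carrier_presented_group)
  let ?q = "rev (map (\<lambda>(b, x). (\<not> b, x)) p)"
  have q: "(?q @ p, []) \<in> pres_rel X R" "?q \<in> words X"
    using word_inverse_cancel[OF p(1)] by auto
  have "word_class X R ?q \<otimes>\<^bsub>presented_group X R\<^esub> P = \<one>\<^bsub>presented_group X R\<^esub>"
    using q p R by (simp add: mult_presented_group one_presented_group word_class_eq_iff)
  then show "\<exists>Q\<in>carrier (presented_group X R).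
      Q \<otimes>\<^bsub>presented_group X R\<^esub> P = \<one>\<^bsub>presented_group X R\<^esub>"
    using q by (auto simp: carrier_presented_group)
qed (auto simp: carrier_presented_group one_presented_group mult_presented_group[OF R])


section \<open>HNN-extensions with cyclic associated subgroups\<close>

text \<open>The stable letter is the generator \<open>None\<close>; the elements of the base group are the generators
  \<open>Some h\<close>, and all the equations \<open>g h = k\<close> that hold in the base group are among the relators.\<close>

definition hnn_relators :: "('a, 'b) monoid_scheme \<Rightarrow> 'a \<Rightarrow> 'a \<Rightarrow> 'a option word set" where
  "hnn_relators K u v =
    {[(True, Some g), (True, Some h), (False, Some (g \<otimes>\<^bsub>K\<^esub> h))] | g h.
       g \<in> carrier K \<and> h \<in> carrier K}
    \<union> {[(False, None), (True, Some u), (True, None), (False, Some v)]}"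

definition hnn_generators :: "('a, 'b) monoid_scheme \<Rightarrow> 'a option set" where
  "hnn_generators K = insert None (Some ` carrier K)"

text \<open>The abstract group \<open>\<langle>K, t | t\<^sup>-\<^sup>1 u t = v\<rangle>\<close>.\<close>

definition hnn_group ::
    "('a, 'b) monoid_scheme \<Rightarrow> 'a \<Rightarrow> 'a \<Rightarrow> 'a option word set monoid" where
  "hnn_group K u v = presented_group (hnn_generators K) (hnn_relators K u v)"

definition hnn_class ::
    "('a, 'b) monoid_scheme \<Rightarrow> 'a \<Rightarrow> 'a \<Rightarrow> 'a option word \<Rightarrow> 'a option word set" where
  "hnn_class K u v = word_class (hnn_generators K) (hnn_relators K u v)"

text \<open>\<open>G\<close> is the HNN-extension \<open>\<langle>H, t | u\<^sup>t = v\<rangle>\<close> of its subgroup \<open>H\<close>, with stable letter the element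
  \<open>t\<close> of \<open>G\<close>: \<open>u \<mapsto> v\<close> extends to an isomorphism of the associated cyclic subgroups, and the abstract
  group is isomorphic to \<open>G\<close> by a map that is the identity on \<open>H\<close> and on \<open>t\<close>.\<close>

definition is_hnn_extension ::
    "('a, 'b) monoid_scheme \<Rightarrow> 'a set \<Rightarrow> 'a \<Rightarrow> 'a \<Rightarrow> 'a \<Rightarrow> bool" where
  "is_hnn_extension G H t u v \<longleftrightarrow>
    subgroup H G \<and> t \<in> carrier G \<and> u \<in> H \<and> v \<in> H \<and>
    (\<exists>\<psi> \<in> iso (G\<lparr>carrier := generate G {u}\<rparr>) (G\<lparr>carrier := generate G {v}\<rparr>). \<psi> u = v) \<and>
    (\<exists>\<phi> \<in> iso (hnn_group (G\<lparr>carrier := H\<rparr>) u v) G.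
       (\<forall>h\<in>H. \<phi> (hnn_class (G\<lparr>carrier := H\<rparr>) u v [(True, Some h)]) = h) \<and>
       \<phi> (hnn_class (G\<lparr>carrier := H\<rparr>) u v [(True, None)]) = t)"

lemma hnn_relators_words:
  assumes "group K" and "u \<in> carrier K" and "v \<in> carrier K"
  shows "hnn_relators K u v \<subseteq> words (hnn_generators K)"
proof -
  interpret group K by fact
  show ?thesis
    using assms(2,3) by (auto simp: hnn_relators_def hnn_generators_def)
qed


section \<open>First-order formulas over groups, algebraic and definable closure\<close>

text \<open>Terms and formulas in the language \<open>{\<cdot>, \<^sup>-\<^sup>1, 1}\<close> with additional constants from \<open>'a\<close>, which
  serve as parameters and are interpreted as themselves.\<close>

datatype (term_params: 'a) gterm =
  Var nat
| Param 'a
| One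
| Mult "'a gterm" "'a gterm"
| Inv "'a gterm"

datatype (fm_params: 'a) gformula =
  Eq "'a gterm" "'a gterm"
| Neg "'a gformula"
| Conj "'a gformula" "'a gformula"
| All nat "'a gformula"

primrec term_vars :: "'a gterm \<Rightarrow> nat set" where
  "term_vars (Var i) = {i}"
| "term_vars (Param a) = {}"
| "term_vars One = {}"
| "term_vars (Mult s t) = term_vars s \<union> term_vars t"
| "term_vars (Inv s) = term_vars s"

primrec free_vars :: "'a gformula \<Rightarrow> nat set" where
  "free_vars (Eq s t) = term_vars s \<union> term_vars t"
| "free_vars (Neg p) = free_vars p"
| "free_vars (Conj p q) = free_vars p \<union> free_vars q"
| "free_vars (All i p) = free_vars p - {i}"

primrec term_val :: "('a, 'b) monoid_scheme \<Rightarrow> (nat \<Rightarrow> 'a) \<Rightarrow> 'a gterm \<Rightarrow> 'a" where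
  "term_val G e (Var i) = e i"
| "term_val G e (Param a) = a"
| "term_val G e One = \<one>\<^bsub>G\<^esub>"
| "term_val G e (Mult s t) = term_val G e s \<otimes>\<^bsub>G\<^esub> term_val G e t"
| "term_val G e (Inv s) = inv\<^bsub>G\<^esub> (term_val G e s)"

primrec sat :: "('a, 'b) monoid_scheme \<Rightarrow> (nat \<Rightarrow> 'a) \<Rightarrow> 'a gformula \<Rightarrow> bool" where
  "sat G e (Eq s t) \<longleftrightarrow> term_val G e s = term_val G e t"
| "sat G e (Neg p) \<longleftrightarrow> \<not> sat G e p"
| "sat G e (Conj p q) \<longleftrightarrow> sat G e p \<and> sat G e q"
| "sat G e (All i p) \<longleftrightarrow> (\<forall>a\<in>carrier G. sat G (e(i := a)) p)"

text \<open>A formula \<open>\<phi>(x)\<close> with parameters from \<open>A\<close> has at most the variable \<open>0\<close> free.\<close>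

definition formulas_over :: "'a set \<Rightarrow> 'a gformula set" where
  "formulas_over A = {p. fm_params p \<subseteq> A \<and> free_vars p \<subseteq> {0}}"

text \<open>Only the value of the valuation at \<open>0\<close> matters here.\<close>

definition solutions :: "('a, 'b) monoid_scheme \<Rightarrow> 'a gformula \<Rightarrow> 'a set" where
  "solutions G p = {c \<in> carrier G. sat G (\<lambda>_. c) p}"

definition acl :: "('a, 'b) monoid_scheme \<Rightarrow> 'a set \<Rightarrow> 'a set" where
  "acl G A = {g. \<exists>p\<in>formulas_over A. g \<in> solutions G p \<and> finite (solutions G p)}"

definition dcl :: "('a, 'b) monoid_scheme \<Rightarrow> 'a set \<Rightarrow> 'a set" where
  "dcl G A = {g. \<exists>p\<in>formulas_over A. g \<in> solutions G p \<and> is_singleton (solutions G p)}"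

end

theory Submission imports Defs begin

text \<open>Let \<open>a\<close>, \<open>b\<close>, \<open>y\<close>, \<open>t\<close> be four
  elements of a basis of the free group \<open>\<Gamma>\<close>, and put

  \<open>p(z) = z a z\<^sup>-\<^sup>1 a z b\<close>, \<open>w(z) = p(z)
  p(z\<^sup>-\<^sup>1)\<close>, \<open>u = w(y)\<close>, \<open>v = t\<^sup>-\<^sup>1 u t\<close>.

  Let \<open>H\<close> be generated by \<open>v\<close> and all basis elements except
  \<open>t\<close>, and let \<open>A\<close> be generated by \<open>v\<close> and all basis
  elements except \<open>t\<close> and \<open>y\<close>. The relation \<open>u\<^sup>t = v\<close>
  only expresses \<open>v\<close> by the basis, so \<open>\<Gamma>\<close> is the HNN-extension of
  \<open>H\<close> with this relation (\<open>hnn_extension_of_basis\<close>). The closures of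
  \<open>A\<close> are found as follows.

  The element \<open>y\<close> is algebraic over \<open>A\<close>, because it solves the formula
  ``\<open>w(z)\<close> is conjugate to \<open>v\<close>'' over \<open>A\<close>, and this formula
  has finitely many solutions. To see the latter, note first that no solution is a word in
  \<open>a\<close> and \<open>b\<close> (\<open>full_conj_core_not_in_subgroup\<close>). From any other
  \<open>z\<close> split off the longest
  initial and final pieces that are words in \<open>a\<close> and \<open>b\<close>. Up to
  conjugation \<open>w(z)\<close> is then cyclically reduced as it stands, and since conjugate
  cyclically reduced words have the same length as \<open>u\<close>, all pieces of
  \<open>z\<close> are single letters at most (\<open>length_red_of_full_conj_core\<close>). So
  \<open>H\<close>, which is generated by \<open>A\<close> and \<open>y\<close>, lies in the
  algebraic closure.

  Conversely, the automorphisms \<open>t \<mapsto> u\<^sup>i t\<close> fix \<open>H\<close>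
  pointwise. An element with a finite orbit under them is fixed by a non-trivial one, and these
  have no fixed points outside \<open>H\<close> (\<open>dehn_twist_fixed_points\<close>): in the
  normal form with respect to \<open>t\<close> a syllable between \<open>t\<^sup>-\<^sup>1\<close>
  and \<open>t\<close> must commute with a power of \<open>u\<close>, which makes it a power of
  \<open>u\<close>, and no other pattern of signs is possible.

  Finally \<open>w\<close> is made so that \<open>w(y\<^sup>-\<^sup>1) = p(y)\<^sup>-\<^sup>1 w(y)
  p(y)\<close>. Hence \<open>y \<mapsto> y\<^sup>-\<^sup>1\<close>, \<open>t \<mapsto>
  p(y)\<^sup>-\<^sup>1 t\<close> is an automorphism of \<open>\<Gamma>\<close> that fixes
  \<open>v\<close>, and its fixed points are exactly the elements of \<open>A\<close>
  (\<open>flip_fixed_points\<close>). Elements definable over \<open>A\<close> are fixed by it, so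
  the definable closure of \<open>A\<close> is \<open>A\<close>. It is a proper subgroup of
  \<open>H\<close> as \<open>y\<close> is moved.\<close>


section \<open>Reduced words\<close>

definition letter_inv :: "bool \<times> 'x \<Rightarrow> bool \<times> 'x" where
  "letter_inv a = (\<not> fst a, snd a)"

definition word_inv :: "'x word \<Rightarrow> 'x word" where
  "word_inv w = rev (map letter_inv w)"

definition reduced :: "'x word \<Rightarrow> bool" where
  "reduced = successively (\<lambda>a b. b \<noteq> letter_inv a)"

text \<open>The letter \<open>a\<close> is put in front of a reduced word and a cancellation that
  this causes is carried out. On reduced words \<open>push a\<close> and \<open>push (letter_inv
  a)\<close> are mutually inverse, so that the free group acts on reduced words; this action
  separates its elements.\<close>

definition push :: "bool \<times> 'x \<Rightarrow> 'x word \<Rightarrow> 'x word" where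
  "push a w = (case w of [] \<Rightarrow> [a] | b # v \<Rightarrow> if b = letter_inv a then v else a # w)"

definition reduce :: "'x word \<Rightarrow> 'x word" where
  "reduce w = foldr push w []"

lemma letter_inv_simps [simp]:
  "letter_inv (letter_inv a) = a" "snd (letter_inv a) = snd a" "fst (letter_inv a) \<longleftrightarrow> \<not> fst a"
  "letter_inv (b, x) = (\<not> b, x)"
  by (auto simp: letter_inv_def)

lemma word_inv_simps [simp]:
  "word_inv [] = []" "word_inv (a # w) = word_inv w @ [letter_inv a]"
  "word_inv (v @ w) = word_inv w @ word_inv v" "word_inv (word_inv w) = w"
  "length (word_inv w) = length w" "word_inv w = [] \<longleftrightarrow> w = []"
  by (auto simp: word_inv_def rev_map o_def)

lemma word_inv_in_words [simp]: "word_inv w \<in> words X \<longleftrightarrow> w \<in> words X"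
  by (induction w) auto

lemma hd_last_word_inv:
  "w \<noteq> [] \<Longrightarrow> hd (word_inv w) = letter_inv (last w)"
  "w \<noteq> [] \<Longrightarrow> last (word_inv w) = letter_inv (hd w)"
  by (simp_all add: word_inv_def hd_rev last_map last_rev hd_map)

lemma words_iff: "w \<in> words X \<longleftrightarrow> snd ` set w \<subseteq> X"
  by (induction w) auto

lemma reduced_simps [simp]:
  "reduced []" "reduced [a]"
  "reduced (a # b # w) \<longleftrightarrow> b \<noteq> letter_inv a \<and> reduced (b # w)"
  by (simp_all add: reduced_def)

lemma reduced_append_iff:
  "reduced (v @ w) \<longleftrightarrow>
    reduced v \<and> reduced w \<and> (v = [] \<or> w = [] \<or> hd w \<noteq> letter_inv (last v))"
  by (simp add: reduced_def successively_append_iff)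

lemma reduced_word_inv [simp]: "reduced (word_inv w) \<longleftrightarrow> reduced w"
proof -
  have *: "reduced (word_inv w)" if "reduced w" for w :: "'x word"
    using that
  proof (induction w)
    case (Cons a w)
    then show ?case
      by (cases w) (auto simp: reduced_append_iff)
  qed simp
  show ?thesis
    using *[of w] *[of "word_inv w"] by auto
qed

lemma reduced_push: "reduced w \<Longrightarrow> reduced (push a w)"
  by (cases w rule: remdups_adj.cases) (auto simp: push_def)

lemma push_reduced: "reduced (a # w) \<Longrightarrow> push a w = a # w"
  by (cases w) (auto simp: push_def)

lemma push_cancel: "reduced w \<Longrightarrow> push a (push (letter_inv a) w) = w"
  by (cases w rule: remdups_adj.cases) (auto simp: push_def)

lemma reduced_reduce: "reduced (reduce w)"
  by (induction w) (auto simp: reduce_def reduced_push)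

lemma reduce_simps [simp]: "reduce [] = []" "reduce (a # w) = push a (reduce w)"
  by (simp_all add: reduce_def)

lemma reduce_reduced: "reduced w \<Longrightarrow> reduce w = w"
proof (induction w)
  case (Cons a w)
  moreover have "reduced w"
    using Cons.prems by (cases w) auto
  ultimately show ?case by (simp add: push_reduced)
qed simp

lemma reduce_in_words: "w \<in> words X \<Longrightarrow> reduce w \<in> words X"
  by (induction w) (auto simp: push_def split: list.splits)

lemma length_reduce_le: "length (reduce w) \<le> length w"
proof (induction w)
  case (Cons a w)
  have "length (push a v) \<le> Suc (length v)" for v
    by (auto simp: push_def split: list.splits)
  with Cons show ?case
    by (fastforce intro: le_trans)
qed simp

lemma reduce_cong_append: "reduce q = reduce q' \<Longrightarrow> reduce (p @ q) = reduce (p @ q')"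
  by (induction p) auto

text \<open>Since \<open>push a\<close> undoes \<open>push (letter_inv a)\<close>, inserting or
  deleting a pair of inverse letters does not change the reduced form. Hence distinct reduced
  words are distinct elements of the free group.\<close>

lemma pres_rel_reduce:
  assumes "(p, q) \<in> pres_rel X {}"
  shows "reduce p = reduce q"
  using assms
proof (induction rule: pres_rel.induct)
  case (cancel p q x b)
  have "reduce ([(b, x), (\<not> b, x)] @ q) = reduce q"
    using push_cancel[OF reduced_reduce, of "(b, x)" q] by simp
  then show ?case
    by (rule reduce_cong_append)
qed auto


section \<open>Free bases\<close>

primrec word_val :: "('a, 'b) monoid_scheme \<Rightarrow> ('x \<Rightarrow> 'a) \<Rightarrow> 'x word \<Rightarrow> 'a" where
  "word_val G e [] = \<one>\<^bsub>G\<^esub>"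
| "word_val G e (a # w) =
    (if fst a then e (snd a) else inv\<^bsub>G\<^esub> e (snd a)) \<otimes>\<^bsub>G\<^esub> word_val G e w"

context group
begin

lemma word_val_closed: "e \<in> X \<rightarrow> carrier G \<Longrightarrow> w \<in> words X \<Longrightarrow> word_val G e w \<in> carrier G"
  by (induction w) auto

lemma word_val_append:
  "e \<in> X \<rightarrow> carrier G \<Longrightarrow> v \<in> words X \<Longrightarrow> w \<in> words X \<Longrightarrow>
    word_val G e (v @ w) = word_val G e v \<otimes> word_val G e w"
  by (induction v) (auto simp: word_val_closed m_assoc Pi_iff)

lemma word_val_push:
  "e \<in> X \<rightarrow> carrier G \<Longrightarrow> a # w \<in> words X \<Longrightarrow> word_val G e (push a w) = word_val G e (a # w)"
  by (cases w)
    (auto simp: push_def word_val_closed m_assoc[symmetric] Pi_iff word_val_closed[of _ X])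

lemma word_val_reduce:
  "e \<in> X \<rightarrow> carrier G \<Longrightarrow> w \<in> words X \<Longrightarrow> word_val G e (reduce w) = word_val G e w"
  by (induction w) (auto simp: word_val_push reduce_in_words)

lemma word_val_word_inv:
  "e \<in> X \<rightarrow> carrier G \<Longrightarrow> w \<in> words X \<Longrightarrow> word_val G e (word_inv w) = inv (word_val G e w)"
  by (induction w) (auto simp: word_val_append[of e X] word_val_closed[of e X] inv_mult_group Pi_iff)

lemma word_val_hom:
  assumes "group K" "\<phi> \<in> hom G K" "e \<in> X \<rightarrow> carrier G" "w \<in> words X"
  shows "\<phi> (word_val G e w) = word_val K (\<phi> \<circ> e) w"
proof -
  interpret \<phi>: group_hom G K \<phi>
    using assms(1,2) by (simp add: group_hom_def group_hom_axioms_def)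
  show ?thesis
    using assms(4) by (induction w) (use assms(3) in \<open>auto simp: word_val_closed[of e X] Pi_iff\<close>)
qed

lemma word_val_in_subgroup:
  "subgroup S G \<Longrightarrow> (\<And>x. x \<in> X \<Longrightarrow> e x \<in> S) \<Longrightarrow> w \<in> words X \<Longrightarrow> word_val G e w \<in> S"
  by (induction w) (auto intro: subgroup.m_closed subgroup.one_closed subgroup.m_inv_closed)

end

lemma word_val_cong: "(\<And>x. x \<in> X \<Longrightarrow> e x = f x) \<Longrightarrow> w \<in> words X \<Longrightarrow> word_val G e w = word_val G f w"
  by (induction w) auto

text \<open>A basis is described by generation and by the non-triviality of non-empty reduced
  words, so that elements of the group can be handled through their unique reduced words
  \<open>red g\<close>.\<close>

locale free_basis = group G for G (structure) +
  fixes X :: "'x set" and e :: "'x \<Rightarrow> 'a"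
  assumes basis_closed: "e \<in> X \<rightarrow> carrier G"
    and span: "carrier G \<subseteq> word_val G e ` words X"
    and indep: "\<And>w. w \<in> words X \<Longrightarrow> reduced w \<Longrightarrow> word_val G e w = \<one> \<Longrightarrow> w = []"
begin

abbreviation val :: "'x word \<Rightarrow> 'a" where
  "val \<equiv> word_val G e"

lemma basis_in_carrier [simp]: "x \<in> X \<Longrightarrow> e x \<in> carrier G"
  using basis_closed by auto

lemmas val_closed [simp] = word_val_closed[OF basis_closed]
lemmas val_append = word_val_append[OF basis_closed]
lemmas val_word_inv = word_val_word_inv[OF basis_closed]

text \<open>If two reduced words begin with different letters, the inverse of the first followed
  by the second is reduced; common initial letters are cancelled beforehand.\<close>

lemma reduced_unique:
  assumes "v \<in> words X" "reduced v" "w \<in> words X" "reduced w" "val v = val w"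
  shows "v = w"
  using assms
proof (induction v arbitrary: w)
  case Nil
  then show ?case using indep[of w] by simp
next
  case (Cons a v)
  show ?case
  proof (cases w)
    case Nil
    then show ?thesis using Cons.prems indep[of "a # v"] by simp
  next
    case w: (Cons b w')
    show ?thesis
    proof (cases "a = b")
      case True
      have "val v = val w'"
        using Cons.prems w True by (auto split: if_splits)
      moreover have "reduced v" "reduced w'"
        using Cons.prems w by (metis append_Cons append_Nil reduced_append_iff)+
      ultimately show ?thesis
        using Cons w True by auto
    next
      case False
      have "reduced (word_inv (a # v) @ w)"
        using Cons.prems(2,4) False w
        by (metis hd_last_word_inv(2) letter_inv_simps(1) list.sel(1) list.simps(3)
            reduced_append_iff reduced_word_inv)
      moreover have "val (word_inv (a # v) @ w) = \<one>"
        using Cons.prems by (simp add: val_append val_word_inv del: word_inv_simps word_val.simps)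
      ultimately have "word_inv (a # v) @ w = []"
        using Cons.prems by (intro indep) auto
      then show ?thesis by simp
    qed
  qed
qed

definition red :: "'a \<Rightarrow> 'x word" where
  "red g = (THE w. w \<in> words X \<and> reduced w \<and> val w = g)"

lemma red_eqI: "w \<in> words X \<Longrightarrow> reduced w \<Longrightarrow> red (val w) = w"
  unfolding red_def by (rule the_equality) (auto intro: reduced_unique)

lemma red_val: "w \<in> words X \<Longrightarrow> red (val w) = reduce w"
  using red_eqI[of "reduce w"] word_val_reduce[OF basis_closed, of w]
  by (simp add: reduce_in_words reduced_reduce)

lemma red_props [simp]:
  assumes "g \<in> carrier G"
  shows "red g \<in> words X" "reduced (red g)" "val (red g) = g"
proof -
  obtain w where "w \<in> words X" "g = val w"
    using span assms by auto
  then show "red g \<in> words X" "reduced (red g)" "val (red g) = g"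
    by (simp_all add: red_val reduce_in_words reduced_reduce word_val_reduce[OF basis_closed])
qed

lemma length_red_le: "w \<in> words X \<Longrightarrow> length (red (val w)) \<le> length w"
  by (simp add: red_val length_reduce_le)

lemma red_eq_Nil_iff: "g \<in> carrier G \<Longrightarrow> red g = [] \<longleftrightarrow> g = \<one>"
  using red_eqI[of "[]"] by (auto dest: red_props(3))

text \<open>The homomorphism with prescribed values on the basis. It is evaluated on reduced
  words, but on any other word it has the expected value too, because reduction does not change
  values in \<open>K\<close>.\<close>

definition lift :: "('c, 'd) monoid_scheme \<Rightarrow> ('x \<Rightarrow> 'c) \<Rightarrow> 'a \<Rightarrow> 'c" where
  "lift K f g = word_val K f (red g)"

lemma lift_val:
  assumes "group K" "f \<in> X \<rightarrow> carrier K" "w \<in> words X"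
  shows "lift K f (val w) = word_val K f w"
  using assms by (simp add: lift_def red_val group.word_val_reduce)

lemma lift_basis:
  assumes "group K" "f \<in> X \<rightarrow> carrier K" "x \<in> X"
  shows "lift K f (e x) = f x"
proof -
  interpret K: group K by fact
  show ?thesis
    using lift_val[OF assms(1,2), of "[(True, x)]"] assms by (auto simp: Pi_iff)
qed

lemma lift_hom:
  assumes "group K" "f \<in> X \<rightarrow> carrier K"
  shows "lift K f \<in> hom G K"
proof (rule homI)
  interpret K: group K by fact
  fix g h assume gh: "g \<in> carrier G" "h \<in> carrier G"
  show "lift K f g \<in> carrier K"
    using gh assms by (auto simp: lift_def intro!: K.word_val_closed[of _ X])
  have "lift K f (val (red g @ red h)) = lift K f g \<otimes>\<^bsub>K\<^esub> lift K f h"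
    using gh assms by (subst lift_val) (auto simp: lift_def K.word_val_append[of f X])
  then show "lift K f (g \<otimes> h) = lift K f g \<otimes>\<^bsub>K\<^esub> lift K f h"
    using gh by (simp add: val_append)
qed

lemma hom_eqI:
  assumes "group K" "\<phi> \<in> hom G K" "\<psi> \<in> hom G K" "\<And>x. x \<in> X \<Longrightarrow> \<phi> (e x) = \<psi> (e x)"
    and "g \<in> carrier G"
  shows "\<phi> g = \<psi> g"
proof -
  have "word_val K (\<phi> \<circ> e) (red g) = word_val K (\<psi> \<circ> e) (red g)"
    using assms by (intro word_val_cong[of X]) auto
  then show ?thesis
    using assms word_val_hom[OF assms(1,2) basis_closed, of "red g"]
      word_val_hom[OF assms(1,3) basis_closed, of "red g"] by simp
qed

lemma automorphismI:
  assumes "\<phi> \<in> hom G G" "\<psi> \<in> hom G G"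
    and "\<And>x. x \<in> X \<Longrightarrow> \<phi> (\<psi> (e x)) = e x" "\<And>x. x \<in> X \<Longrightarrow> \<psi> (\<phi> (e x)) = e x"
  shows "\<phi> \<in> iso G G"
proof -
  have "\<phi> \<circ> \<psi> \<in> hom G G" "\<psi> \<circ> \<phi> \<in> hom G G" "id \<in> hom G G"
    using assms(1,2) by (auto simp: hom_def Pi_iff)
  from hom_eqI[OF is_group this(1,3)] hom_eqI[OF is_group this(2,3)]
  have "\<phi> (\<psi> g) = g" "\<psi> (\<phi> g) = g" if "g \<in> carrier G" for g
    using assms(3,4) that by auto
  then have "bij_betw \<phi> (carrier G) (carrier G)"
    using assms by (intro bij_betw_byWitness[of _ \<psi>]) (auto simp: hom_def)
  then show ?thesis
    using assms by (simp add: iso_def)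
qed

end

lemma word_val_presented_group:
  assumes R: "R \<subseteq> words X" and "w \<in> words X"
  shows "word_val (presented_group X R) (\<lambda>x. word_class X R [(True, x)]) w = word_class X R w"
  using assms(2)
proof (induction w)
  case Nil
  then show ?case by (simp add: one_presented_group)
next
  case (Cons a w)
  let ?P = "presented_group X R" and ?e = "\<lambda>x. word_class X R [(True, x)]"
  interpret P: group ?P
    using R by (rule group_presented_group)
  have cl: "word_class X R v \<in> carrier ?P" if "v \<in> words X" for v
    using that by (auto simp: carrier_presented_group)
  have "inv\<^bsub>?P\<^esub> ?e x = word_class X R [(False, x)]" if "x \<in> X" for x
  proof (rule P.inv_equality)
    show "word_class X R [(False, x)] \<otimes>\<^bsub>?P\<^esub> ?e x = \<one>\<^bsub>?P\<^esub>"
      using that R pres_rel.cancel[of "[]" X "[]" x False R]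
      by (simp add: mult_presented_group one_presented_group word_class_eq_iff)
  qed (use that in \<open>auto intro!: cl\<close>)
  then have "(if fst a then ?e (snd a) else inv\<^bsub>?P\<^esub> ?e (snd a)) = word_class X R [a]"
    using Cons.prems by (cases a) auto
  then show ?case
    using Cons R mult_presented_group[OF R, of "[a]" w] by simp
qed

text \<open>The universal property of a presentation (von Dyck's theorem).\<close>

lemma presented_group_lift:
  assumes "group G" "R \<subseteq> words X" "f \<in> X \<rightarrow> carrier G" "\<And>r. r \<in> R \<Longrightarrow> word_val G f r = \<one>\<^bsub>G\<^esub>"
  obtains \<phi> where "\<phi> \<in> hom (presented_group X R) G"
    "\<And>w. w \<in> words X \<Longrightarrow> \<phi> (word_class X R w) = word_val G f w"
proof
  interpret group G by fact
  have rel: "word_val G f p = word_val G f q" if "(p, q) \<in> pres_rel X R" for p q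
    using that
  proof (induction rule: pres_rel.induct)
    case (cancel p q x b)
    moreover have "word_val G f ([(b, x), (\<not> b, x)] @ q) = word_val G f q"
      using cancel assms(3) word_val_closed[OF assms(3), of q]
      by (cases b) (auto simp: m_assoc[symmetric] Pi_iff)
    ultimately show ?case
      using word_val_append[OF assms(3), of p "[(b, x), (\<not> b, x)] @ q"]
      by (simp add: word_val_append[OF assms(3)])
  next
    case (relator p q r)
    then have "r \<in> words X"
      using assms(2) by auto
    then show ?case
      using relator assms(4) word_val_closed[OF assms(3)]
      by (simp add: word_val_append[OF assms(3)])
  qed auto
  define \<phi> where "\<phi> C = the_elem (word_val G f ` C)" for C
  show \<phi>: "\<phi> (word_class X R w) = word_val G f w" if "w \<in> words X" for w
  proof -
    have "word_val G f ` word_class X R w = {word_val G f w}"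
      using that rel by (auto simp: word_class_def intro: pres_rel.refl)
    then show ?thesis by (simp add: \<phi>_def)
  qed
  show "\<phi> \<in> hom (presented_group X R) G"
    by (rule homI) (auto simp: carrier_presented_group \<phi> mult_presented_group[OF assms(2)]
        word_val_append[OF assms(3)] word_val_closed[OF assms(3)])
qed

lemma free_of_rank_basis:
  assumes "free_of_rank G n"
  obtains e where "free_basis G {..<n} e"
proof -
  let ?X = "{..<n}" and ?F = "free_group {..<n}"
  have G: "group G" and F: "group ?F"
    using assms group_presented_group[of "{}" ?X] by (auto simp: free_of_rank_def free_group_def)
  obtain \<phi> where "\<phi> \<in> iso ?F G"
    using assms F group.iso_sym by (auto simp: free_of_rank_def is_iso_def)
  then have \<phi>: "\<phi> \<in> hom ?F G" "bij_betw \<phi> (carrier ?F) (carrier G)"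
    by (auto simp: iso_def)
  define e where "e x = word_class ?X {} [(True, x)]" for x
  have cl: "word_class ?X {} w \<in> carrier ?F" if "w \<in> words ?X" for w
    using that by (auto simp: free_group_def carrier_presented_group)
  have e: "e \<in> ?X \<rightarrow> carrier ?F"
    using cl by (auto simp: e_def)
  interpret F: group ?F by fact
  have val: "word_val ?F e w = word_class ?X {} w" if "w \<in> words ?X" for w
    using word_val_presented_group[of "{}" ?X w] that by (simp add: e_def[abs_def] free_group_def)
  have val': "word_val G (\<phi> \<circ> e) w = \<phi> (word_class ?X {} w)" if "w \<in> words ?X" for w
    using F.word_val_hom[OF G \<phi>(1) e that] val[OF that] by simp
  have "free_basis G ?X (\<phi> \<circ> e)"
  proof (intro free_basis.intro free_basis_axioms.intro G)
    show "\<phi> \<circ> e \<in> ?X \<rightarrow> carrier G"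
      using e \<phi>(1) by (auto simp: hom_def)
    have "carrier G = \<phi> ` word_class ?X {} ` words ?X"
      using \<phi>(2) by (simp add: bij_betw_def free_group_def carrier_presented_group)
    then show "carrier G \<subseteq> word_val G (\<phi> \<circ> e) ` words ?X"
      using val' by force
  next
    fix w assume w: "w \<in> words ?X" "reduced w" "word_val G (\<phi> \<circ> e) w = \<one>\<^bsub>G\<^esub>"
    have "\<phi> (word_class ?X {} w) = \<phi> (word_class ?X {} [])"
      using w val'[of w] val'[of "[]"] by simp
    then have "word_class ?X {} w = word_class ?X {} []"
      using \<phi>(2) cl w by (meson bij_betw_imp_inj_on inj_onD words_simps(1))
    then have "reduce w = reduce []"
      using w by (intro pres_rel_reduce) (auto simp: word_class_eq_iff)
    then show "w = []"
      using w by (simp add: reduce_reduced)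
  qed
  then show thesis by (rule that)
qed


section \<open>Normal forms with respect to one basis element\<close>

lemma words_mono: "w \<in> words Y \<Longrightarrow> Y \<subseteq> X \<Longrightarrow> w \<in> words X"
  by (auto simp: words_iff)

context free_basis
begin

lemma red_one [simp]: "red \<one> = []"
  by (simp add: red_eq_Nil_iff)

text \<open>The subgroup generated by the basis elements other than \<open>e s\<close>. The whole
  group is the free product of this subgroup with the infinite cyclic group generated by \<open>e
  s\<close>.\<close>

definition others :: "'x \<Rightarrow> 'a set" where
  "others s = val ` words (X - {s})"

lemma others_subgroup: "subgroup (others s) G"
proof (rule subgroupI)
  show "others s \<subseteq> carrier G"
    using words_mono[of _ "X - {s}" X] by (auto simp: others_def)
  show "others s \<noteq> {}"
    using words_simps(1)[of "X - {s}"] unfolding others_def by blast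
  fix g assume "g \<in> others s"
  then obtain v where v: "v \<in> words (X - {s})" "g = val v"
    by (auto simp: others_def)
  note vX = words_mono[OF v(1), of X]
  show "inv g \<in> others s"
    using v vX val_word_inv[of v] by (metis Diff_subset imageI others_def word_inv_in_words)
  fix h assume "h \<in> others s"
  then obtain w where w: "w \<in> words (X - {s})" "h = val w"
    by (auto simp: others_def)
  have "g \<otimes> h = val (v @ w)"
    using v w vX words_mono[OF w(1), of X] by (simp add: val_append)
  then show "g \<otimes> h \<in> others s"
    using v w by (auto simp: others_def)
qed

lemmas others_closed [simp] = subgroup.mem_carrier[OF others_subgroup]
lemmas others_intros [simp, intro] = subgroup.one_closed[OF others_subgroup]
  subgroup.m_closed[OF others_subgroup] subgroup.m_inv_closed[OF others_subgroup]

lemma basis_in_others [simp]: "x \<in> X \<Longrightarrow> x \<noteq> s \<Longrightarrow> e x \<in> others s"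
  unfolding others_def by (rule image_eqI[of _ _ "[(True, x)]"]) auto

lemma red_others: "g \<in> others s \<Longrightarrow> red g \<in> words (X - {s})"
  using words_mono[of _ "X - {s}" X]
  by (auto simp: others_def red_val intro!: reduce_in_words)

lemma others_red_inj: "g \<in> others s \<Longrightarrow> h \<in> others s \<Longrightarrow> red g = red h \<Longrightarrow> g = h"
  by (drule others_closed)+ (metis red_props(3))

abbreviation signed :: "bool \<Rightarrow> 'x \<Rightarrow> 'a" where
  "signed b x \<equiv> if b then e x else inv e x"

text \<open>The list \<open>[(b\<^sub>1, g\<^sub>1), (b\<^sub>2, g\<^sub>2), \<dots>]\<close> with
  head \<open>g\<close> stands for \<open>g s\<^sup>\<plusminus> g\<^sub>1 s\<^sup>\<plusminus>
  g\<^sub>2 \<dots>\<close>. The powers of \<open>e s\<close> are written out letter by letter, so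
  \<open>pinch_free\<close> admits a trivial syllable between equal signs, but not between
  opposite ones. This is the normal form that an automorphism \<open>s \<mapsto> q s\<close>
  respects.\<close>

primrec syllable_prod :: "'x \<Rightarrow> 'a \<Rightarrow> (bool \<times> 'a) list \<Rightarrow> 'a" where
  "syllable_prod s g [] = g"
| "syllable_prod s g (p # L) = g \<otimes> (signed (fst p) s \<otimes> syllable_prod s (snd p) L)"

primrec pinch_free :: "'x \<Rightarrow> 'a \<Rightarrow> (bool \<times> 'a) list \<Rightarrow> bool" where
  "pinch_free s g [] \<longleftrightarrow> g \<in> others s"
| "pinch_free s g (p # L) \<longleftrightarrow> g \<in> others s \<and> pinch_free s (snd p) L \<and>
    (L \<noteq> [] \<and> snd p = \<one> \<longrightarrow> fst (hd L) = fst p)"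

primrec syllable_word :: "'x \<Rightarrow> 'a \<Rightarrow> (bool \<times> 'a) list \<Rightarrow> 'x word" where
  "syllable_word s g [] = red g"
| "syllable_word s g (p # L) = red g @ (fst p, s) # syllable_word s (snd p) L"

lemma pinch_free_others: "pinch_free s g L \<Longrightarrow> g \<in> others s"
  by (cases L) auto

lemma pinch_free_head: "pinch_free s g L \<Longrightarrow> h \<in> others s \<Longrightarrow> pinch_free s h L"
  by (cases L) auto

lemma syllable_prod_closed:
  "s \<in> X \<Longrightarrow> pinch_free s g L \<Longrightarrow> syllable_prod s g L \<in> carrier G"
  by (induction L arbitrary: g) auto

lemma syllable_prod_mult:
  assumes "s \<in> X" "pinch_free s g L" "h \<in> carrier G"
  shows "syllable_prod s (h \<otimes> g) L = h \<otimes> syllable_prod s g L"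
  using assms by (cases L) (auto simp: m_assoc syllable_prod_closed)

lemma hd_syllable_word:
  assumes "pinch_free s g L" "syllable_word s g L \<noteq> []" "snd (hd (syllable_word s g L)) = s"
  shows "g = \<one> \<and> L \<noteq> [] \<and> hd (syllable_word s g L) = (fst (hd L), s)"
proof -
  have g: "g \<in> others s"
    using assms(1) by (rule pinch_free_others)
  have "red g = []"
  proof (rule ccontr)
    assume ne: "red g \<noteq> []"
    then have "hd (syllable_word s g L) = hd (red g)"
      by (cases L) auto
    then show False
      using ne assms(3) red_others[OF g] by (cases "red g") auto
  qed
  moreover from this have "g = \<one>"
    using g by (simp add: red_eq_Nil_iff)
  ultimately show ?thesis
    using assms(2,3) by (cases L) simp_all
qed

text \<open>The reduced words of the syllables, joined by the letters \<open>s\<close>, cannot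
  cancel: a syllable contains no letter \<open>s\<close>, and adjacent letters \<open>s\<close>
  have equal signs. The normal form is therefore visible in the reduced word, at the occurrences
  of the letter \<open>s\<close>.\<close>

lemma syllable_word_props:
  assumes "s \<in> X" "pinch_free s g L"
  shows "syllable_word s g L \<in> words X \<and> reduced (syllable_word s g L) \<and>
    val (syllable_word s g L) = syllable_prod s g L"
  using assms(2)
proof (induction L arbitrary: g)
  case Nil
  then show ?case by simp
next
  case (Cons p L)
  let ?w = "syllable_word s (snd p) L"
  have g: "g \<in> others s" and L: "pinch_free s (snd p) L"
    using Cons.prems by auto
  have w: "?w \<in> words X" "reduced ?w" "val ?w = syllable_prod s (snd p) L"
    using Cons.IH[OF L] by auto
  have "reduced ((fst p, s) # ?w)"
  proof (cases "?w = []")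
    case False
    have "hd ?w \<noteq> (\<not> fst p, s)"
      using hd_syllable_word[OF L False] Cons.prems by (cases "snd (hd ?w) = s") auto
    then show ?thesis
      using False w(2) by (cases ?w) auto
  qed simp
  moreover have "(fst p, s) \<noteq> letter_inv (last (red g))" if "red g \<noteq> []"
  proof -
    have "snd (last (red g)) \<noteq> s"
      using red_others[OF g] last_in_set[OF that] unfolding words_iff by blast
    then show ?thesis by (cases "last (red g)") auto
  qed
  ultimately show ?case
    using assms(1) g w by (auto simp: reduced_append_iff val_append)
qed

lemma append_letter_eq:
  assumes "v @ (b, s) # w = v' @ (b', s) # w'" "s \<notin> snd ` set v" "s \<notin> snd ` set v'"
  shows "v = v' \<and> b = b' \<and> w = w'"
  using assms
proof (induction v arbitrary: v')
  case Nil
  then show ?case by (cases v') auto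
next
  case (Cons a v)
  then show ?case by (cases v') auto
qed

lemma syllable_word_inj:
  assumes "pinch_free s g L" "pinch_free s g' L'" "syllable_word s g L = syllable_word s g' L'"
  shows "g = g' \<and> L = L'"
  using assms
proof (induction L arbitrary: g L' g')
  case Nil
  have s: "s \<notin> snd ` set (red g)"
    using red_others[of g s] Nil by (auto simp: words_iff)
  have "L' = []"
    using Nil s by (cases L') auto
  then show ?case
    using Nil others_red_inj by simp
next
  case (Cons p L)
  have g: "g \<in> others s" "g' \<in> others s"
    using Cons.prems pinch_free_others by blast+
  have s: "s \<notin> snd ` set (red g)" "s \<notin> snd ` set (red g')"
    using red_others[OF g(1)] red_others[OF g(2)] by (auto simp: words_iff)
  have "L' \<noteq> []"
  proof
    assume "L' = []"
    then have "red g' = red g @ (fst p, s) # syllable_word s (snd p) L"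
      using Cons.prems(3) by simp
    then show False
      using s(2) by simp
  qed
  then obtain p' L1 where L': "L' = p' # L1"
    by (cases L') auto
  have "red g = red g' \<and> fst p = fst p' \<and> syllable_word s (snd p) L = syllable_word s (snd p') L1"
    using Cons.prems(3) s unfolding L' by (intro append_letter_eq[of _ _ s]) auto
  moreover from this have "snd p = snd p' \<and> L = L1"
    using Cons.prems unfolding L' by (intro Cons.IH) auto
  ultimately show ?case
    using others_red_inj[OF g] by (simp add: L' prod_eq_iff)
qed

lemma syllable_prod_inj:
  assumes "s \<in> X" "pinch_free s g L" "pinch_free s g' L'"
    and "syllable_prod s g L = syllable_prod s g' L'"
  shows "g = g' \<and> L = L'"
  using assms syllable_word_props[of s g L] syllable_word_props[of s g' L']
  by (intro syllable_word_inj) (auto intro: reduced_unique)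

lemma syllable_prod_exists:
  assumes "s \<in> X" "g \<in> carrier G"
  obtains h L where "pinch_free s h L" "syllable_prod s h L = g"
proof -
  have "\<exists>h L. pinch_free s h L \<and> syllable_prod s h L = val w" if "w \<in> words X" for w
    using that
  proof (induction w)
    case Nil
    show ?case by (rule exI[of _ \<one>], rule exI[of _ "[]"]) simp
  next
    case (Cons a w)
    obtain b x where a: "a = (b, x)" by fastforce
    obtain h L where h: "pinch_free s h L" "syllable_prod s h L = val w"
      using Cons by auto
    note hc = pinch_free_others[OF h(1)]
    show ?case
    proof (cases "x = s")
      case False
      then have "signed b x \<in> others s"
        using Cons.prems a by auto
      then show ?thesis
        using h hc a assms(1) syllable_prod_mult[OF assms(1) h(1), of "signed b x"]
        by (intro exI[of _ "signed b x \<otimes> h"] exI[of _ L]) (auto intro: pinch_free_head[OF h(1)])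
    next
      case x: True
      show ?thesis
      proof (cases "h = \<one> \<and> L \<noteq> [] \<and> fst (hd L) \<noteq> b")
        case True
        then obtain p L1 where L: "L = p # L1" by (cases L) auto
        have "val w = signed (\<not> b) s \<otimes> syllable_prod s (snd p) L1"
          using h True L assms(1) syllable_prod_closed[OF assms(1), of "snd p" L1] by auto
        then have "syllable_prod s (snd p) L1 = val (a # w)"
          using h L a x assms(1) syllable_prod_closed[OF assms(1), of "snd p" L1]
          by (auto simp: m_assoc[symmetric])
        moreover have "pinch_free s (snd p) L1"
          using h L by simp
        ultimately show ?thesis by blast
      next
        case False
        then show ?thesis
          using h a x syllable_prod_closed[OF assms(1) h(1)] assms(1)
          by (intro exI[of _ \<one>] exI[of _ "(b, h) # L"]) auto
      qed
    qed
  qed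
  then show thesis
    using that assms(2) red_props[of g] by metis
qed

end


section \<open>Fixed points of automorphisms that twist a basis element\<close>

text \<open>An endomorphism that preserves the free factor \<open>others s\<close>, is injective
  on it, and multiplies the remaining basis element by an element of this factor. Such a map sends
  normal forms to normal forms with the same pattern of signs, so a fixed point has to satisfy one
  equation in \<open>others s\<close> for each syllable.\<close>

locale basis_twist = free_basis G X e for G (structure) and X :: "'x set" and e +
  fixes s :: 'x and \<phi> :: "'a \<Rightarrow> 'a" and q :: 'a
  assumes s_basis: "s \<in> X" and hom: "\<phi> \<in> hom G G"
    and image_others: "g \<in> others s \<Longrightarrow> \<phi> g \<in> others s"
    and kernel_others: "g \<in> others s \<Longrightarrow> \<phi> g = \<one> \<Longrightarrow> g = \<one>"
    and q_others: "q \<in> others s" and twist: "\<phi> (e s) = q \<otimes> e s"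
begin

text \<open>The image of a syllable absorbs the factors \<open>q\<close> and
  \<open>q\<^sup>-\<^sup>1\<close> that the images of the neighbouring letters
  \<open>s\<^sup>\<plusminus>\<close> contribute: \<open>q\<close> from a letter \<open>s\<close>
  on its right, and \<open>q\<^sup>-\<^sup>1\<close> from a letter
  \<open>s\<^sup>-\<^sup>1\<close> on its left. The head has a right neighbour only.\<close>

definition twist_head :: "'a \<Rightarrow> (bool \<times> 'a) list \<Rightarrow> 'a" where
  "twist_head g L = \<phi> g \<otimes> (if L \<noteq> [] \<and> fst (hd L) then q else \<one>)"

primrec twist_tail :: "(bool \<times> 'a) list \<Rightarrow> (bool \<times> 'a) list" where
  "twist_tail [] = []"
| "twist_tail (p # L) =
    (fst p, (if fst p then \<one> else inv q) \<otimes> twist_head (snd p) L) # twist_tail L"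

lemma twist_head_others: "g \<in> others s \<Longrightarrow> twist_head g L \<in> others s"
  by (auto simp: twist_head_def image_others q_others)

lemma hd_twist_tail: "L \<noteq> [] \<Longrightarrow> fst (hd (twist_tail L)) = fst (hd L)"
  by (cases L) auto

lemma twist_tail_Nil [simp]: "twist_tail L = [] \<longleftrightarrow> L = []"
  by (cases L) auto

text \<open>Between opposite signs a syllable \<open>h\<close> becomes \<open>\<phi> h\<close> or
  \<open>q\<^sup>-\<^sup>1 (\<phi> h) q\<close>, and neither becomes trivial unless
  \<open>h\<close> is.\<close>

lemma pinch_free_twist:
  assumes "pinch_free s g L"
  shows "pinch_free s (twist_head g L) (twist_tail L)"
  using assms
proof (induction L arbitrary: g)
  case Nil
  then show ?case by (simp add: twist_head_others)
next
  case (Cons p L)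
  obtain b h where p: "p = (b, h)" by fastforce
  have g: "g \<in> others s" and h: "h \<in> others s" and L: "pinch_free s h L"
    using Cons.prems p pinch_free_others by auto
  let ?h = "(if b then \<one> else inv q) \<otimes> twist_head h L"
  have h': "?h \<in> others s"
    using twist_head_others[OF h] q_others by auto
  have "fst (hd L) = b" if "L \<noteq> []" "?h = \<one>"
  proof (rule ccontr)
    assume b: "fst (hd L) \<noteq> b"
    have "\<phi> h = \<one>"
    proof (cases b)
      case True
      then show ?thesis
        using that b image_others[OF h] by (simp add: twist_head_def)
    next
      case False
      have "\<phi> h = q \<otimes> (inv q \<otimes> (\<phi> h \<otimes> q)) \<otimes> inv q"
        using image_others[OF h] q_others by (simp add: m_assoc) (simp add: m_assoc[symmetric])
      also have "inv q \<otimes> (\<phi> h \<otimes> q) = \<one>"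
        using that b False by (simp add: twist_head_def)
      finally show ?thesis
        using q_others by simp
    qed
    then have "h = \<one>"
      using h by (rule kernel_others[rotated])
    then show False
      using Cons.prems p b that by simp
  qed
  then show ?case
    using p twist_head_others[OF g] h' pinch_free_head[OF Cons.IH[OF L] h'] hd_twist_tail[of L]
    by auto
qed

lemma twist_syllable_prod:
  assumes "pinch_free s g L"
  shows "\<phi> (syllable_prod s g L) = syllable_prod s (twist_head g L) (twist_tail L)"
  using assms
proof (induction L arbitrary: g)
  case Nil
  then show ?case
    using image_others[of g] by (simp add: twist_head_def)
next
  case (Cons p L)
  interpret \<phi>: group_hom G G \<phi>
    using hom by unfold_locales
  have g: "g \<in> others s" and h: "snd p \<in> others s" and L: "pinch_free s (snd p) L"
    using Cons.prems pinch_free_others by auto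
  let ?h = "twist_head (snd p) L" and ?L = "twist_tail L"
  let ?P = "syllable_prod s ?h ?L"
  have P: "?P \<in> carrier G"
    using syllable_prod_closed[OF s_basis pinch_free_twist[OF L]] .
  have "\<phi> (syllable_prod s g (p # L)) = \<phi> g \<otimes> (\<phi> (signed (fst p) s) \<otimes> ?P)"
    using g s_basis syllable_prod_closed[OF s_basis L] by (simp add: Cons.IH[OF L])
  also have "\<dots> = twist_head g (p # L) \<otimes> (signed (fst p) s \<otimes> ((if fst p then \<one> else inv q) \<otimes> ?P))"
    using g s_basis P q_others image_others[OF g]
    by (auto simp: twist_head_def twist m_assoc inv_mult_group)
  also have "(if fst p then \<one> else inv q) \<otimes> ?P
      = syllable_prod s ((if fst p then \<one> else inv q) \<otimes> ?h) ?L"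
    using q_others by (intro syllable_prod_mult[symmetric] s_basis pinch_free_twist L) auto
  finally show ?case by simp
qed

text \<open>In a fixed point \<open>g s\<^sup>\<plusminus> g\<^sub>1 s\<^sup>\<plusminus>
  \<dots>\<close> the syllables fulfil equations: by \<open>right\<close> the first sign, if there
  is one, is negative, by \<open>left\<close> it is followed by a positive one, and the syllable
  \<open>g\<^sub>1\<close> between them satisfies the equation in \<open>conj\<close>. So the
  point begins with a fixed syllable and a conjugate \<open>s\<^sup>-\<^sup>1 g\<^sub>1 s\<close>,
  both in \<open>S\<close>, and the rest is again fixed.\<close>

lemma fixed_points_subset:
  assumes S: "subgroup S G"
    and fixed: "\<And>g. g \<in> others s \<Longrightarrow> \<phi> g = g \<Longrightarrow> g \<in> S"
    and right: "\<And>g. g \<in> others s \<Longrightarrow> \<phi> g \<otimes> q \<noteq> g"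
    and left: "\<And>g. g \<in> others s \<Longrightarrow> inv q \<otimes> \<phi> g \<noteq> g"
    and conj: "\<And>g. g \<in> others s \<Longrightarrow> inv q \<otimes> (\<phi> g \<otimes> q) = g \<Longrightarrow> inv (e s) \<otimes> g \<otimes> e s \<in> S"
    and g: "g \<in> carrier G" "\<phi> g = g"
  shows "g \<in> S"
proof -
  have *: "syllable_prod s g L \<in> S"
    if "pinch_free s g L" "twist_head g L = g" "twist_tail L = L" for g L
    using that
  proof (induction "length L" arbitrary: g L rule: less_induct)
    case less
    have g: "g \<in> others s"
      using less.prems(1) by (rule pinch_free_others)
    show ?case
    proof (cases L)
      case Nil
      then show ?thesis
        using less.prems(2) g fixed[OF g] image_others[OF g] by (simp add: twist_head_def)
    next
      case (Cons p L1)
      have p: "\<not> fst p"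
        using less.prems(2) right[OF g] Cons by (auto simp: twist_head_def)
      then have gS: "g \<in> S"
        using less.prems(2) g fixed[OF g] image_others[OF g] Cons by (simp add: twist_head_def)
      have h: "snd p \<in> others s"
        using less.prems(1) Cons pinch_free_others by auto
      have ph: "inv q \<otimes> twist_head (snd p) L1 = snd p" "twist_tail L1 = L1"
        using less.prems(3) Cons p by (auto simp: prod_eq_iff)
      have "L1 \<noteq> [] \<and> fst (hd L1)"
      proof (rule ccontr)
        assume "\<not> ?thesis"
        then have "twist_head (snd p) L1 = \<phi> (snd p)"
          using image_others[OF h] by (auto simp: twist_head_def)
        then show False
          using left[OF h] ph(1) by simp
      qed
      then obtain p2 L2 where L1: "L1 = p2 # L2" "fst p2"
        by (cases L1) auto
      have cS: "inv (e s) \<otimes> snd p \<otimes> e s \<in> S"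
        using conj[OF h] ph(1) L1 by (simp add: twist_head_def)
      have pf: "pinch_free s (snd p2) L2"
        using less.prems(1) Cons L1 by auto
      have "syllable_prod s (snd p2) L2 \<in> S"
      proof (rule less.hyps[OF _ pf])
        show "twist_head (snd p2) L2 = snd p2" "twist_tail L2 = L2"
          using ph(2) L1 twist_head_others[OF pinch_free_others[OF pf], of L2]
          by (auto simp: prod_eq_iff)
      qed (simp add: Cons L1)
      then have "g \<otimes> ((inv (e s) \<otimes> snd p \<otimes> e s) \<otimes> syllable_prod s (snd p2) L2) \<in> S"
        using gS cS S by (simp add: subgroup.m_closed)
      then show ?thesis
        using Cons p L1 h g s_basis syllable_prod_closed[OF s_basis pf] by (simp add: m_assoc)
    qed
  qed
  obtain h L where h: "pinch_free s h L" "syllable_prod s h L = g"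
    using syllable_prod_exists[OF s_basis g(1)] .
  have "twist_head h L = h \<and> twist_tail L = L"
    using g h twist_syllable_prod[OF h(1)]
    by (intro syllable_prod_inj[OF s_basis pinch_free_twist[OF h(1)] h(1)]) simp
  then show ?thesis
    using * h by auto
qed

end


section \<open>Conjugacy and centralizers in free groups\<close>

text \<open>Copies of \<open>w\<close> can be removed from the front of \<open>v\<close> as long
  as \<open>v\<close> is not shorter than \<open>w\<close>; a non-empty remainder \<open>v\<close>
  would give \<open>w = v r = r v\<close>, that is, a non-trivial rotation that fixes
  \<open>w\<close>.\<close>

lemma pow_commuting_with_power_of_primitive:
  assumes "v @ concat (replicate (Suc k) w) = concat (replicate (Suc k) w) @ v"
    and "w \<noteq> []" and prim: "\<And>m. 0 < m \<Longrightarrow> m < length w \<Longrightarrow> rotate m w \<noteq> w"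
  shows "\<exists>m. v = concat (replicate m w)"
  using assms(1)
proof (induction v rule: length_induct)
  case (1 v)
  define P where "P = concat (replicate k w)"
  have "w @ concat (replicate n w) = concat (replicate n w) @ w" for n
    by (induction n) auto
  then have Pw: "w @ P = P @ w" by (simp add: P_def)
  have eq: "v @ w @ P = w @ P @ v"
    using "1.prems" by (simp add: P_def)
  show ?case
  proof (cases "length w \<le> length v")
    case True
    have "take (length w) v = w"
      using arg_cong[OF eq, of "take (length w)"] True by simp
    then obtain v' where v: "v = w @ v'"
      by (metis append_take_drop_id)
    have "v' @ w @ P = w @ P @ v'"
      using eq Pw by (simp add: v)
    moreover have "length v' < length v"
      using assms(2) by (simp add: v)
    ultimately obtain m where "v' = concat (replicate m w)"
      using "1.IH" by (auto simp: P_def)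
    then have "v = concat (replicate (Suc m) w)"
      by (simp add: v)
    then show ?thesis by blast
  next
    case False
    have "take (length v) w = v"
      using arg_cong[OF eq, of "take (length v)"] False by simp
    then obtain r where w: "w = v @ r"
      by (metis append_take_drop_id)
    have "w @ P = r @ P @ v"
      using eq by (simp add: w)
    moreover have "\<exists>z. P @ v = v @ z"
      by (cases k) (auto simp: P_def w)
    ultimately have "v @ r = r @ v"
      by (auto simp: w) (metis append_eq_append_conv append.assoc length_append add.commute)
    then have "rotate (length v) w = w"
      by (metis w rotate_append)
    then have "v = []"
      using prim[of "length v"] False by auto
    then show ?thesis
      by (intro exI[of _ 0]) simp
  qed
qed

lemma reduced_append_cancellation:
  assumes "reduced v" "reduced w"
  shows "\<exists>v' r w'. v = v' @ r \<and> w = word_inv r @ w' \<and> reduced (v' @ w')"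
  using assms
proof (induction v arbitrary: w rule: rev_induct)
  case Nil
  then show ?case by (intro exI[of _ "[]"] exI[of _ w]) simp
next
  case (snoc a v)
  show ?case
  proof (cases "w \<noteq> [] \<and> hd w = letter_inv a")
    case True
    then obtain w1 where w: "w = letter_inv a # w1"
      by (cases w) auto
    have "reduced v" "reduced w1"
      using snoc.prems reduced_append_iff[of v "[a]"] reduced_append_iff[of "[letter_inv a]" w1]
      by (auto simp: w)
    then obtain v' r w' where *: "v = v' @ r" "w1 = word_inv r @ w'" "reduced (v' @ w')"
      using snoc.IH by blast
    then have "v @ [a] = v' @ (r @ [a]) \<and> w = word_inv (r @ [a]) @ w'"
      by (simp add: w)
    with *(3) show ?thesis by blast
  next
    case False
    then have "reduced ((v @ [a]) @ w)"
      using snoc.prems reduced_append_iff[of "v @ [a]" w] by auto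
    then show ?thesis
      by (intro exI[of _ "v @ [a]"] exI[of _ "[]"] exI[of _ w]) simp
  qed
qed

lemma reduced_power:
  assumes "reduced (w @ w)"
  shows "reduced (concat (replicate n w))"
proof (cases "w = []")
  case False
  have "hd (concat (replicate (Suc n) w)) = hd w" for n
    using False by simp
  moreover have "reduced w" "hd w \<noteq> letter_inv (last w)"
    using assms False by (auto simp: reduced_append_iff)
  ultimately show ?thesis
  proof (induction n)
    case (Suc n)
    then show ?case
      by (cases n) (auto simp: reduced_append_iff)
  qed simp
qed simp

lemma power_in_words: "w \<in> words X \<Longrightarrow> concat (replicate n w) \<in> words X"
  by (induction n) auto

context free_basis
begin

lemma mult_inv_cancel:
  "x \<in> carrier G \<Longrightarrow> r \<in> carrier G \<Longrightarrow> y \<in> carrier G \<Longrightarrow> (x \<otimes> r) \<otimes> (inv r \<otimes> y) = x \<otimes> y"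
  by (simp add: m_assoc) (simp add: m_assoc[symmetric])

lemma val_power: "w \<in> words X \<Longrightarrow> val (concat (replicate n w)) = val w [^] n"
proof (induction n)
  case (Suc n)
  then show ?case
    using nat_pow_Suc2[of "val w" n] by (simp add: val_append power_in_words del: nat_pow_Suc)
qed simp

text \<open>A cyclically reduced word is shortest in its conjugacy class: the powers of
  \<open>w\<close> are reduced, whereas the conjugates of the powers of \<open>c\<close> grow at
  most by \<open>length c\<close> per factor, up to the bounded contribution of
  \<open>h\<close>.\<close>

lemma length_cyclically_reduced_le:
  assumes w: "w \<in> words X" "reduced (w @ w)" and c: "c \<in> words X" and h: "h \<in> carrier G"
    and eq: "val w = h \<otimes> val c \<otimes> inv h"
  shows "length w \<le> length c"
proof (rule ccontr)
  assume less: "\<not> length w \<le> length c"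
  \<comment> \<open>An exponent for which the contribution of the conjugator is outweighed.\<close>
  define N where "N = Suc (2 * length (red h))"
  have pow: "val w [^] n = h \<otimes> val c [^] n \<otimes> inv h" for n :: nat
  proof (induction n)
    case (Suc n)
    then show ?case
      using c h by (simp add: eq m_assoc) (simp add: m_assoc[symmetric])
  qed (use h in simp)
  have "val (concat (replicate N w)) = val (red h @ concat (replicate N c) @ word_inv (red h))"
    using w c h by (simp add: val_power val_append val_word_inv power_in_words pow m_assoc)
  then have "length (red (val (concat (replicate N w))))
      \<le> length (red h @ concat (replicate N c) @ word_inv (red h))"
    using length_red_le[of "red h @ concat (replicate N c) @ word_inv (red h)"] c h
    by (simp add: power_in_words)
  then have "N * length w \<le> 2 * length (red h) + N * length c"
    using w by (simp add: red_eqI reduced_power power_in_words length_concat sum_list_replicate)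
  moreover have "N * Suc (length c) \<le> N * length w"
    using less by (intro mult_le_mono2) simp
  ultimately show False
    by (simp add: N_def)
qed

text \<open>Multiplying \<open>g\<close> by a large power of \<open>w\<close>, with which it
  commutes, makes its reduced word begin and end like a power of \<open>w\<close>. Then nothing
  cancels in the two products, and commuting in the group becomes commuting of lists.\<close>

lemma centralizer_of_primitive:
  assumes w: "w \<in> words X" "reduced (w @ w)" "w \<noteq> []"
    and prim: "\<And>m. 0 < m \<Longrightarrow> m < length w \<Longrightarrow> rotate m w \<noteq> w"
    and k: "0 < k" and g: "g \<in> carrier G" and comm: "g \<otimes> val w [^] (k::nat) = val w [^] k \<otimes> g"
  shows "g \<in> generate G {val w}"
proof -
  define W where "W = concat (replicate k w)"
  define N where "N = Suc (length (red g))"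
  define V where "V = concat (replicate N W)"
  have W: "W \<in> words X" "W \<noteq> []" "val W = val w [^] k"
    using w k by (auto simp: W_def power_in_words val_power)
  have "W @ W = concat (replicate (k + k) w)"
    by (simp add: W_def replicate_add)
  then have WW: "reduced (W @ W)"
    using reduced_power[OF w(2)] by simp
  have V: "V \<in> words X" "reduced V" "hd V = hd W" "last V = last W" "V \<noteq> []"
  proof -
    have "V = W @ concat (replicate (length (red g)) W)"
      by (simp add: V_def N_def)
    moreover have "V = concat (replicate (length (red g)) W) @ W"
      by (simp add: V_def N_def replicate_append_same[symmetric])
    ultimately show "hd V = hd W" "last V = last W" "V \<noteq> []"
      using W(2) by (metis hd_append2, metis last_appendR, simp)
  qed (simp_all add: V_def power_in_words W WW reduced_power)
  have "1 \<le> length W"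
    using W(2) by (cases W) auto
  then have "N * 1 \<le> N * length W"
    by (intro mult_le_mono2)
  then have len: "length (red g) < length V"
    by (simp add: V_def length_concat sum_list_replicate N_def)
  have commW: "g \<otimes> val W = val W \<otimes> g"
    using comm W by simp
  have commV: "g \<otimes> val V = val V \<otimes> g"
  proof -
    have "g \<otimes> val W [^] n = val W [^] n \<otimes> g" for n :: nat
    proof (induction n)
      case (Suc n)
      have "g \<otimes> val W [^] Suc n = (g \<otimes> val W [^] n) \<otimes> val W"
        using g W(1) by (simp add: m_assoc)
      also have "\<dots> = val W [^] n \<otimes> (g \<otimes> val W)"
        using Suc g W(1) by (simp add: m_assoc)
      also have "\<dots> = val W [^] Suc n \<otimes> g"
        using g W(1) commW by (simp add: m_assoc)
      finally show ?case .
    qed (use g in simp)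
    then show ?thesis
      using W(1) by (simp add: V_def val_power)
  qed
  define v where "v = red (g \<otimes> val V)"
  have v: "v \<in> words X" "reduced v" "val v = g \<otimes> val V"
    using g V by (simp_all add: v_def)
  \<comment> \<open>Fewer letters cancel than \<open>V\<close> has, so its outer end survives in \<open>g V\<close> and in \<open>V g\<close>.\<close>
  have "v \<noteq> []" "last v = last W"
  proof -
    obtain x r y where *: "red g = x @ r" "V = word_inv r @ y" "reduced (x @ y)"
      using reduced_append_cancellation[of "red g" V] g V by auto
    have "x \<in> words X" "r \<in> words X" "y \<in> words X"
      using * g V by (metis red_props(1) words_simps(3) word_inv_in_words)+
    moreover from this have "g = val x \<otimes> val r" "val V = inv (val r) \<otimes> val y"
      using *(1,2) red_props(3)[OF g] by (simp_all add: val_append val_word_inv)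
    ultimately have "g \<otimes> val V = val (x @ y)" "x @ y \<in> words X"
      by (simp_all add: val_append mult_inv_cancel)
    then have "v = x @ y"
      using *(3) by (simp add: v_def red_eqI)
    moreover have "y \<noteq> []"
      using len *(1,2) by auto
    moreover from this have "last y = last W"
      using *(2) V by simp
    ultimately show "v \<noteq> []" "last v = last W"
      by simp_all
  qed
  moreover have "hd v = hd W"
  proof -
    obtain x r y where *: "V = x @ r" "red g = word_inv r @ y" "reduced (x @ y)"
      using reduced_append_cancellation[of V "red g"] g V by auto
    have "x \<in> words X" "r \<in> words X" "y \<in> words X"
      using * g V by (metis red_props(1) words_simps(3) word_inv_in_words)+
    moreover from this have "val V = val x \<otimes> val r" "g = inv (val r) \<otimes> val y"
      using *(1,2) red_props(3)[OF g] by (simp_all add: val_append val_word_inv)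
    ultimately have "val V \<otimes> g = val (x @ y)" "x @ y \<in> words X"
      by (simp_all add: val_append mult_inv_cancel)
    then have "v = x @ y"
      using *(3) by (simp add: v_def red_eqI commV)
    moreover have "x \<noteq> []"
      using len *(1,2) by auto
    moreover from this have "hd x = hd W"
      using *(1) V by simp
    ultimately show ?thesis
      by simp
  qed
  ultimately have "reduced (v @ W)" "reduced (W @ v)"
    using v(2) WW W(2) by (simp_all add: reduced_append_iff)
  moreover have "val (v @ W) = val (W @ v)"
  proof -
    have "val W \<otimes> val V = val V \<otimes> val W"
      using W(1) nat_pow_Suc2[of "val W" N] by (simp add: V_def val_power)
    then have "g \<otimes> val V \<otimes> val W = val W \<otimes> (g \<otimes> val V)"
      using g W(1) V(1) commW by (metis m_assoc val_closed)
    then show ?thesis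
      using W(1) v by (simp add: val_append)
  qed
  ultimately have "v @ W = W @ v"
    using v W by (intro reduced_unique) auto
  moreover obtain k' where "k = Suc k'"
    using k by (cases k) auto
  ultimately obtain m where m: "v = concat (replicate m w)"
    using pow_commuting_with_power_of_primitive[of v k' w] w(3) prim by (auto simp: W_def)
  have "generate G {val w} \<subseteq> carrier G" and sg: "subgroup (generate G {val w}) G"
    using w by (auto intro!: generate_incl generate_is_subgroup)
  have pow: "val w [^] n \<in> generate G {val w}" for n :: nat
    by (induction n) (auto intro: generate.intros)
  have "val V \<in> generate G {val w}"
    using w by (simp add: V_def val_power power_in_words W_def nat_pow_pow pow)
  moreover have "g \<otimes> val V \<in> generate G {val w}"
    using v(3) m w pow[of m] by (simp add: val_power)
  ultimately have "(g \<otimes> val V) \<otimes> inv (val V) \<in> generate G {val w}"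
    using sg by (meson subgroup.m_closed subgroup.m_inv_closed)
  then show ?thesis
    using g V by (simp add: m_assoc)
qed

end


section \<open>HNN-extensions inside a free group\<close>

lemma (in group) conj_mult:
  "\<lbrakk>g \<in> carrier G; h \<in> carrier G; t \<in> carrier G\<rbrakk> \<Longrightarrow>
    (inv t \<otimes> g \<otimes> t) \<otimes> (inv t \<otimes> h \<otimes> t) = inv t \<otimes> (g \<otimes> h) \<otimes> t"
  by (simp add: m_assoc) (simp add: m_assoc[symmetric])

lemma (in group) conj_hom: "t \<in> carrier G \<Longrightarrow> (\<lambda>g. inv t \<otimes> g \<otimes> t) \<in> hom G G"
  by (intro homI) (auto simp: conj_mult)

lemma (in group) generate_conj:
  assumes "t \<in> carrier G" "u \<in> carrier G"
  shows "generate G {inv t \<otimes> u \<otimes> t} = (\<lambda>g. inv t \<otimes> g \<otimes> t) ` generate G {u}"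
proof -
  interpret c: group_hom G G "\<lambda>g. inv t \<otimes> g \<otimes> t"
    using conj_hom[OF assms(1)] by unfold_locales
  show ?thesis
    using c.generate_img[of "{u}"] assms by simp
qed

text \<open>The relation \<open>u\<^sup>t = v\<close> merely defines \<open>v\<close>, so the
  HNN-extension has the same generators as the free group and no relation between them. Precisely,
  the natural map from the HNN-extension to \<open>G\<close> is inverted by the homomorphism that
  sends \<open>e s\<close> to the stable letter and every other basis element to itself. That this
  homomorphism is the inclusion on all of \<open>H\<close> has to be checked on the generators of
  \<open>H\<close>; for \<open>v\<close> it is the defining relation of the HNN-extension.\<close>

lemma (in free_basis) hnn_extension_of_basis:
  assumes s: "s \<in> X" and u: "u \<in> others s"
  defines "v \<equiv> inv (e s) \<otimes> u \<otimes> e s"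
  defines "H \<equiv> generate G (insert v (e ` (X - {s})))"
  shows "is_hnn_extension G H (e s) u v"
proof -
  let ?K = "G\<lparr>carrier := H\<rparr>" and ?P = "hnn_group (G\<lparr>carrier := H\<rparr>) u v"
  let ?Y = "hnn_generators ?K" and ?R = "hnn_relators ?K u v"
  let ?class = "word_class ?Y ?R"
  have es: "e s \<in> carrier G" and uG: "u \<in> carrier G" and vG: "v \<in> carrier G"
    using s u by (auto simp: v_def)
  have gens: "insert v (e ` (X - {s})) \<subseteq> carrier G"
    using vG by auto
  have H: "subgroup H G"
    unfolding H_def using gens by (rule generate_is_subgroup)
  then have HG: "H \<subseteq> carrier G"
    by (rule subgroup.subset)
  have vH: "v \<in> H" and eH: "\<And>x. x \<in> X \<Longrightarrow> x \<noteq> s \<Longrightarrow> e x \<in> H"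
    unfolding H_def by (auto intro: generate.incl)
  have othersH: "others s \<subseteq> H"
    unfolding others_def using eH word_val_in_subgroup[OF H, of "X - {s}" e] by auto
  have uH: "u \<in> H"
    using u othersH by auto
  have K: "group ?K"
    using H by (rule subgroup.subgroup_is_group) (rule is_group)
  have R: "?R \<subseteq> words ?Y"
    using hnn_relators_words[OF K] uH vH by simp
  have P: "group ?P"
    unfolding hnn_group_def using R by (rule group_presented_group)
  interpret P: group ?P by (rule P)
  define c where "c x = ?class [(True, x)]" for x
  have c_closed: "c x \<in> carrier ?P" if "x \<in> ?Y" for x
    using that by (auto simp: c_def hnn_group_def carrier_presented_group)
  have val_c: "word_val ?P c w = ?class w" if "w \<in> words ?Y" for w
    using word_val_presented_group[OF R that] by (simp add: c_def[abs_def] hnn_group_def)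
  have c_rel: "word_val ?P c r = \<one>\<^bsub>?P\<^esub>" if "r \<in> ?R" for r
  proof -
    have r: "r \<in> words ?Y"
      using that R by auto
    have "(r, []) \<in> pres_rel ?Y ?R"
      using pres_rel.relator[of "[]" ?Y "[]" r ?R] that by simp
    then have "?class r = ?class []"
      using word_class_eq_iff[OF R r, of "[]"] by simp
    then show ?thesis
      unfolding val_c[OF r] by (simp add: hnn_group_def one_presented_group)
  qed
  have SomeY: "Some h \<in> ?Y" if "h \<in> H" for h
    using that by (simp add: hnn_generators_def)
  have NoneY: "None \<in> ?Y"
    by (simp add: hnn_generators_def)
  have c_mult: "c (Some (g \<otimes> h)) = c (Some g) \<otimes>\<^bsub>?P\<^esub> c (Some h)" if "g \<in> H" "h \<in> H" for g h
  proof -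
    have gh: "g \<otimes> h \<in> H"
      using that H by (simp add: subgroup.m_closed)
    have "word_val ?P c [(True, Some g), (True, Some h), (False, Some (g \<otimes> h))] = \<one>\<^bsub>?P\<^esub>"
      by (rule c_rel) (use that in \<open>auto simp: hnn_relators_def\<close>)
    then have "c (Some g) \<otimes>\<^bsub>?P\<^esub> c (Some h) \<otimes>\<^bsub>?P\<^esub> inv\<^bsub>?P\<^esub> c (Some (g \<otimes> h)) = \<one>\<^bsub>?P\<^esub>"
      using that gh by (simp add: c_closed SomeY P.m_assoc)
    then show ?thesis
      using that gh c_closed[OF SomeY] P.inv_equality[of "c (Some g) \<otimes>\<^bsub>?P\<^esub> c (Some h)" "inv\<^bsub>?P\<^esub> c (Some (g \<otimes> h))"]
      by (metis P.inv_closed P.inv_inv P.m_closed)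
  qed
  have cK: "(\<lambda>h. c (Some h)) \<in> hom ?K ?P"
    by (rule homI) (auto simp: c_mult c_closed SomeY)
  interpret cK: group_hom ?K ?P "\<lambda>h. c (Some h)"
    using K P cK by (simp add: group_hom_def group_hom_axioms_def)
  have c_conj: "c (Some v) = inv\<^bsub>?P\<^esub> c None \<otimes>\<^bsub>?P\<^esub> c (Some u) \<otimes>\<^bsub>?P\<^esub> c None"
  proof -
    have "word_val ?P c [(False, None), (True, Some u), (True, None), (False, Some v)] = \<one>\<^bsub>?P\<^esub>"
      by (rule c_rel) (auto simp: hnn_relators_def)
    then have "inv\<^bsub>?P\<^esub> c None \<otimes>\<^bsub>?P\<^esub> c (Some u) \<otimes>\<^bsub>?P\<^esub> c None \<otimes>\<^bsub>?P\<^esub> inv\<^bsub>?P\<^esub> c (Some v) = \<one>\<^bsub>?P\<^esub>"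
      using uH vH by (simp add: c_closed SomeY NoneY P.m_assoc)
    then show ?thesis
      using uH vH c_closed[OF SomeY] c_closed[OF NoneY]
        P.inv_equality[of "inv\<^bsub>?P\<^esub> c None \<otimes>\<^bsub>?P\<^esub> c (Some u) \<otimes>\<^bsub>?P\<^esub> c None" "inv\<^bsub>?P\<^esub> c (Some v)"]
      by (metis P.inv_closed P.inv_inv P.m_closed)
  qed
  define f where "f x = (case x of None \<Rightarrow> e s | Some h \<Rightarrow> h)" for x
  have f: "f \<in> ?Y \<rightarrow> carrier G"
    using es HG by (auto simp: f_def hnn_generators_def)
  \<comment> \<open>The relators hold in the free group, which gives the natural map.\<close>
  have f_rel: "word_val G f r = \<one>" if "r \<in> ?R" for r
  proof -
    have gh: "g \<otimes> (h \<otimes> inv (g \<otimes> h)) = \<one>" if "g \<in> H" "h \<in> H" for g h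
    proof -
      have "g \<in> carrier G" "h \<in> carrier G"
        using that HG by auto
      then show ?thesis
        by (subst m_assoc[symmetric]) simp_all
    qed
    have "v \<otimes> z = inv (e s) \<otimes> (u \<otimes> (e s \<otimes> z))" if "z \<in> carrier G" for z
      using that es uG by (simp add: v_def m_assoc)
    then have "inv (e s) \<otimes> (u \<otimes> (e s \<otimes> inv v)) = \<one>"
      using r_inv[OF vG] inv_closed[OF vG] by metis
    with gh show ?thesis
      using that es uG vG HG H by (auto simp: hnn_relators_def f_def subgroup.m_closed subsetD)
  qed
  obtain \<phi> where \<phi>: "\<phi> \<in> hom ?P G" and \<phi>_class: "\<And>w. w \<in> words ?Y \<Longrightarrow> \<phi> (?class w) = word_val G f w"
    using presented_group_lift[OF is_group R f f_rel] unfolding hnn_group_def by blast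
  have \<phi>_c: "\<phi> (c x) = f x" if "x \<in> ?Y" for x
    using \<phi>_class[of "[(True, x)]"] that f by (simp add: c_def Pi_iff)
  \<comment> \<open>The images of the basis elements under the inverse map.\<close>
  define b where "b x = c (if x = s then None else Some (e x))" for x
  have b: "b \<in> X \<rightarrow> carrier ?P"
    using eH by (auto simp: b_def intro!: c_closed SomeY NoneY)
  define \<psi> where "\<psi> = lift ?P b"
  have \<psi>: "\<psi> \<in> hom G ?P" and \<psi>_e: "\<And>x. x \<in> X \<Longrightarrow> \<psi> (e x) = b x"
    using lift_hom[OF P b] lift_basis[OF P b] by (auto simp: \<psi>_def)
  interpret \<psi>: group_hom G ?P \<psi>
    using P \<psi> by (simp add: group_hom_def group_hom_axioms_def)
  have \<phi>_\<psi>: "\<phi> (\<psi> g) = g" if "g \<in> carrier G" for g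
  proof -
    have "(\<phi> \<circ> \<psi>) g = id g"
    proof (rule hom_eqI[OF is_group _ _ _ that])
      show "\<phi> \<circ> \<psi> \<in> hom G G" "id \<in> hom G G"
        using \<phi> \<psi> by (auto simp: hom_def Pi_iff)
      show "(\<phi> \<circ> \<psi>) (e x) = id (e x)" if "x \<in> X" for x
        using that \<phi>_c[of "if x = s then None else Some (e x)"] eH[OF that] SomeY NoneY
        by (auto simp: \<psi>_e b_def f_def)
    qed
    then show ?thesis by simp
  qed
  have inv_K: "inv\<^bsub>?K\<^esub> h = inv h" if "h \<in> H" for h
    using that H by (simp add: m_inv_consistent)
  have \<psi>_others: "\<psi> g = c (Some g)" if g: "g \<in> others s" for g
  proof -
    obtain w where w: "w \<in> words (X - {s})" "g = val w"
      using g by (auto simp: others_def)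
    have wX: "w \<in> words X"
      using w words_mono[of w "X - {s}" X] by auto
    have "c (Some (val w)) = word_val ?P b w \<and> val w \<in> H" using w(1)
    proof (induction w)
      case Nil
      then show ?case
        using cK.hom_one H by (simp add: subgroup.one_closed)
    next
      case (Cons a w)
      then have a: "snd a \<in> X" "snd a \<noteq> s" and IH: "c (Some (val w)) = word_val ?P b w" "val w \<in> H"
        by auto
      have "signed (fst a) (snd a) \<in> H"
        using eH[OF a] H by (simp add: subgroup.m_inv_closed)
      moreover have "c (Some (inv (e (snd a)))) = inv\<^bsub>?P\<^esub> c (Some (e (snd a)))"
        using cK.hom_inv[of "e (snd a)"] eH[OF a] inv_K by simp
      moreover have "b (snd a) = c (Some (e (snd a)))"
        using a by (simp add: b_def)
      ultimately show ?case
        using IH H by (simp add: c_mult subgroup.m_closed split: if_splits)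
    qed
    then show ?thesis
      using w(2) wX lift_val[OF P b wX] by (simp add: \<psi>_def)
  qed
  have \<psi>_H: "\<psi> h = c (Some h)" if "h \<in> H" for h
  proof -
    have base: "\<psi> g = c (Some g)" if "g \<in> insert v (e ` (X - {s}))" for g
    proof (cases "g = v")
      case True
      then show ?thesis
        using es uG \<psi>_e[OF s] \<psi>_others[OF u] c_conj by (simp add: v_def b_def)
    next
      case False
      then show ?thesis
        using that by (auto simp: \<psi>_others)
    qed
    show ?thesis
      using that unfolding H_def
    proof (induction rule: generate.induct)
      case one
      then show ?case using cK.hom_one \<psi>.hom_one by simp
    next
      case (incl h)
      then show ?case by (rule base)
    next
      case (inv h)
      then have "h \<in> H" unfolding H_def by (rule generate.incl)
      then show ?case
        using base[OF inv] cK.hom_inv[of h] inv_K[of h] HG by auto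
    next
      case (eng h1 h2)
      then have "h1 \<in> H" "h2 \<in> H" unfolding H_def by auto
      then show ?case
        using eng by (simp add: c_mult subsetD[OF HG])
    qed
  qed
  have \<psi>_\<phi>: "\<psi> (\<phi> C) = C" if C: "C \<in> carrier ?P" for C
  proof -
    obtain w where w: "w \<in> words ?Y" "C = ?class w"
      using C by (auto simp: hnn_group_def carrier_presented_group)
    have "\<psi> (\<phi> C) = word_val ?P (\<psi> \<circ> f) w"
      using word_val_hom[OF P \<psi> f w(1)] w by (simp add: \<phi>_class)
    also have "\<dots> = word_val ?P c w"
    proof (rule word_val_cong[OF _ w(1)])
      fix x assume "x \<in> ?Y"
      then consider "x = None" | h where "x = Some h" "h \<in> H"
        by (auto simp: hnn_generators_def)
      then show "(\<psi> \<circ> f) x = c x"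
        using \<psi>_e[OF s] by cases (simp_all add: f_def b_def \<psi>_H)
    qed
    finally show ?thesis
      using w val_c by simp
  qed
  have "bij_betw \<phi> (carrier ?P) (carrier G)"
    using \<phi>_\<psi> \<psi>_\<phi> hom_carrier[OF \<phi>] hom_carrier[OF \<psi>] by (intro bij_betw_byWitness[of _ \<psi>]) auto
  then have "\<phi> \<in> iso ?P G"
    using \<phi> by (simp add: iso_def)
  moreover have "\<forall>h\<in>H. \<phi> (hnn_class ?K u v [(True, Some h)]) = h"
    using \<phi>_c SomeY by (simp add: hnn_class_def c_def f_def)
  moreover have "\<phi> (hnn_class ?K u v [(True, None)]) = e s"
    using \<phi>_c[OF NoneY] by (simp add: hnn_class_def c_def f_def)
  moreover have "(\<lambda>g. inv (e s) \<otimes> g \<otimes> e s)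
      \<in> iso (G\<lparr>carrier := generate G {u}\<rparr>) (G\<lparr>carrier := generate G {v}\<rparr>)"
  proof -
    have sub: "generate G {u} \<subseteq> carrier G"
      using uG by (intro generate_incl) auto
    have img: "generate G {v} = (\<lambda>g. inv (e s) \<otimes> g \<otimes> e s) ` generate G {u}"
      using generate_conj[OF es uG] by (simp add: v_def)
    have "inj_on (\<lambda>g. inv (e s) \<otimes> g \<otimes> e s) (generate G {u})"
      using sub es by (intro inj_onI) (auto simp: subset_iff)
    then show ?thesis
      using sub es by (auto simp: iso_def hom_def bij_betw_def img conj_mult subset_iff)
  qed
  ultimately show ?thesis
    unfolding is_hnn_extension_def using H es uH vH
    by (intro conjI bexI[of _ "\<lambda>g. inv (e s) \<otimes> g \<otimes> e s"] bexI[of _ \<phi>]) (simp_all add: v_def)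
qed


section \<open>Algebraic and definable closure\<close>

lemma term_val_automorphism:
  assumes "\<sigma> \<in> iso G G" "group G" "term_params p \<subseteq> carrier G" "\<And>a. a \<in> term_params p \<Longrightarrow> \<sigma> a = a"
    and "\<And>i. e i \<in> carrier G"
  shows "term_val G e p \<in> carrier G \<and> term_val G (\<sigma> \<circ> e) p = \<sigma> (term_val G e p)"
proof -
  interpret group G by fact
  interpret \<sigma>: group_hom G G \<sigma>
    using assms(1) by unfold_locales (simp add: iso_def)
  show ?thesis
    using assms(3,4,5) by (induction p) auto
qed

lemma sat_automorphism:
  assumes "\<sigma> \<in> iso G G" "group G" "fm_params p \<subseteq> carrier G" "\<And>a. a \<in> fm_params p \<Longrightarrow> \<sigma> a = a"
    and "\<And>i. e i \<in> carrier G"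
  shows "sat G (\<sigma> \<circ> e) p \<longleftrightarrow> sat G e p"
  using assms(3,4,5)
proof (induction p arbitrary: e)
  case (Eq r q)
  have "inj_on \<sigma> (carrier G)"
    using assms(1) by (auto simp: iso_def bij_betw_def)
  moreover have "term_val G e r \<in> carrier G \<and> term_val G (\<sigma> \<circ> e) r = \<sigma> (term_val G e r)"
    "term_val G e q \<in> carrier G \<and> term_val G (\<sigma> \<circ> e) q = \<sigma> (term_val G e q)"
    by (rule term_val_automorphism[OF assms(1,2)]; use Eq in auto)+
  ultimately show ?case
    unfolding sat.simps by (metis inj_onD)
next
  case (All i p)
  have surj: "carrier G = \<sigma> ` carrier G"
    using assms(1) by (auto simp: iso_def bij_betw_def)
  have "sat G ((\<sigma> \<circ> e)(i := \<sigma> a)) p \<longleftrightarrow> sat G (e(i := a)) p" if "a \<in> carrier G" for a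
  proof -
    have "(\<sigma> \<circ> e)(i := \<sigma> a) = \<sigma> \<circ> (e(i := a))"
      by auto
    moreover have "sat G (\<sigma> \<circ> (e(i := a))) p \<longleftrightarrow> sat G (e(i := a)) p"
      by (rule All.IH) (use All.prems that in auto)
    ultimately show ?thesis by (simp only:)
  qed
  then show ?case
    unfolding sat.simps by (subst surj) simp
qed auto

lemma solutions_automorphism:
  assumes "group G" "\<sigma> \<in> iso G G" "A \<subseteq> carrier G" "\<And>a. a \<in> A \<Longrightarrow> \<sigma> a = a"
    and "p \<in> formulas_over A" "g \<in> solutions G p"
  shows "\<sigma> g \<in> solutions G p"
proof -
  have "sat G (\<sigma> \<circ> (\<lambda>_. g)) p \<longleftrightarrow> sat G (\<lambda>_. g) p"
    using assms by (intro sat_automorphism) (auto simp: formulas_over_def solutions_def)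
  then show ?thesis
    using assms by (auto simp: solutions_def o_def iso_def hom_def)
qed

lemma dcl_fixed:
  assumes "group G" "\<sigma> \<in> iso G G" "A \<subseteq> carrier G" "\<And>a. a \<in> A \<Longrightarrow> \<sigma> a = a" "g \<in> dcl G A"
  shows "\<sigma> g = g"
proof -
  obtain p h where p: "p \<in> formulas_over A" "g \<in> solutions G p" "solutions G p = {h}"
    using assms(5) by (auto simp: dcl_def is_singleton_def)
  then show ?thesis
    using solutions_automorphism[OF assms(1-4) p(1,2)] by simp
qed

lemma acl_finite_orbit:
  assumes "group G" "A \<subseteq> carrier G" "g \<in> acl G A"
    and "\<And>i. \<sigma> i \<in> iso G G" "\<And>i a. a \<in> A \<Longrightarrow> \<sigma> i a = a"
  shows "finite (range (\<lambda>i. \<sigma> i g))"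
proof -
  obtain p where p: "p \<in> formulas_over A" "g \<in> solutions G p" "finite (solutions G p)"
    using assms(3) by (auto simp: acl_def)
  have "range (\<lambda>i. \<sigma> i g) \<subseteq> solutions G p"
    using solutions_automorphism[OF assms(1,4,2,5) p(1,2)] by auto
  then show ?thesis
    using p(3) finite_subset by auto
qed

lemma subset_dcl: "A \<subseteq> carrier G \<Longrightarrow> A \<subseteq> dcl G A"
proof
  fix a assume "A \<subseteq> carrier G" "a \<in> A"
  then have "solutions G (Eq (Var 0) (Param a)) = {a}"
    by (auto simp: solutions_def)
  then show "a \<in> dcl G A"
    using \<open>a \<in> A\<close> unfolding dcl_def
    by (intro CollectI bexI[of _ "Eq (Var 0) (Param a)"]) (auto simp: formulas_over_def)
qed

lemma term_val_cong: "(\<And>i. i \<in> term_vars r \<Longrightarrow> e i = f i) \<Longrightarrow> term_val G e r = term_val G f r"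
  by (induction r) auto

lemma sat_cong: "(\<And>i. i \<in> free_vars p \<Longrightarrow> e i = f i) \<Longrightarrow> sat G e p \<longleftrightarrow> sat G f p"
proof (induction p arbitrary: e f)
  case (Eq r q)
  have "term_val G e r = term_val G f r" "term_val G e q = term_val G f q"
    by (rule term_val_cong; use Eq in simp)+
  then show ?case by simp
next
  case (Neg p)
  have "sat G e p \<longleftrightarrow> sat G f p"
    by (rule Neg.IH) (use Neg.prems in simp)
  then show ?case by simp
next
  case (Conj p q)
  have "sat G e p \<longleftrightarrow> sat G f p" "sat G e q \<longleftrightarrow> sat G f q"
    by (rule Conj.IH; use Conj.prems in simp)+
  then show ?case by simp
next
  case (All i p)
  have "sat G (e(i := a)) p \<longleftrightarrow> sat G (f(i := a)) p" for a
    by (rule All.IH) (use All.prems in auto)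
  then show ?case by simp
qed

lemma generate_term:
  assumes "h \<in> generate G (insert z A)"
  shows "\<exists>r. term_params r \<subseteq> A \<and> term_vars r \<subseteq> {1} \<and> (\<forall>e. e 1 = z \<longrightarrow> term_val G e r = h)"
  using assms
proof (induction rule: generate.induct)
  case one
  show ?case by (rule exI[of _ One]) simp
next
  case (incl h)
  show ?case
    by (rule exI[of _ "if h = z then Var 1 else Param h"]) (use incl in auto)
next
  case (inv h)
  show ?case
    by (rule exI[of _ "Inv (if h = z then Var 1 else Param h)"]) (use inv in auto)
next
  case (eng h1 h2)
  then obtain r1 r2 where "term_params r1 \<subseteq> A \<and> term_vars r1 \<subseteq> {1} \<and> (\<forall>e. e 1 = z \<longrightarrow> term_val G e r1 = h1)"
    "term_params r2 \<subseteq> A \<and> term_vars r2 \<subseteq> {1} \<and> (\<forall>e. e 1 = z \<longrightarrow> term_val G e r2 = h2)"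
    by blast
  then show ?case
    by (intro exI[of _ "Mult r1 r2"]) auto
qed

text \<open>If \<open>z\<close> is one of finitely many solutions of a formula over
  \<open>A\<close>, then an element \<open>r(z)\<close>, with a term \<open>r\<close> over
  \<open>A\<close>, is one of the finitely many values of \<open>r\<close> at these solutions. The
  formula for \<open>z\<close> has the free variable \<open>1\<close>, which is then bound by a
  quantifier, and the variable \<open>0\<close> is kept for the value.\<close>

lemma generate_insert_subset_acl:
  assumes G: "group G" and A: "A \<subseteq> carrier G" and p: "fm_params p \<subseteq> A" "free_vars p \<subseteq> {1}"
    and z: "z \<in> carrier G" "sat G (\<lambda>_. z) p" and fin: "finite {z \<in> carrier G. sat G (\<lambda>_. z) p}"
  shows "generate G (insert z A) \<subseteq> acl G A"
proof
  interpret group G by fact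
  fix h assume h: "h \<in> generate G (insert z A)"
  then obtain r where r: "term_params r \<subseteq> A" "term_vars r \<subseteq> {1}"
    and val: "\<And>e. e 1 = z \<Longrightarrow> term_val G e r = h"
    using generate_term[OF h] by (elim exE conjE) auto
  let ?S = "{z \<in> carrier G. sat G (\<lambda>_. z) p}"
  have hG: "h \<in> carrier G"
    using h z A generate_incl[of "insert z A"] by auto
  define q where "q = Neg (All 1 (Neg (Conj p (Eq (Var 0) r))))"
  have q: "q \<in> formulas_over A"
    using p r by (auto simp: q_def formulas_over_def)
  have sat_p: "sat G ((\<lambda>_. x)(1 := y)) p \<longleftrightarrow> sat G (\<lambda>_. y) p" for x y
    by (rule sat_cong) (use p in auto)
  have val_r: "term_val G ((\<lambda>_. x)(1 := y)) r = term_val G (\<lambda>_. y) r" for x y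
    by (rule term_val_cong) (use r in auto)
  have "solutions G q = {x \<in> carrier G. \<exists>y\<in>?S. x = term_val G (\<lambda>_. y) r}"
    using sat_p val_r by (auto simp: solutions_def q_def)
  then have sol: "h \<in> solutions G q" "solutions G q \<subseteq> (\<lambda>y. term_val G (\<lambda>_. y) r) ` ?S"
    using hG z val[of "\<lambda>_. z"] by auto
  then have "finite (solutions G q)"
    using fin finite_surj by blast
  then show "h \<in> acl G A"
    using q sol unfolding acl_def by blast
qed


section \<open>A rigid conjugacy class\<close>

lemma (in group) mult_cancel_left [simp]:
  "x \<in> carrier G \<Longrightarrow> z \<in> carrier G \<Longrightarrow> x \<otimes> (inv x \<otimes> z) = z"
  "x \<in> carrier G \<Longrightarrow> z \<in> carrier G \<Longrightarrow> inv x \<otimes> (x \<otimes> z) = z"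
  by (simp_all add: m_assoc[symmetric])

lemma split_at_outer_letters:
  assumes "w \<notin> words Y"
  obtains u v u' where "w = u @ v @ u'" "u \<in> words Y" "u' \<in> words Y" "v \<noteq> []"
    "snd (hd v) \<notin> Y" "snd (last v) \<notin> Y"
proof -
  have "\<exists>x\<in>set w. snd x \<notin> Y"
    using assms by (auto simp: words_iff)
  then obtain u x r where w: "w = u @ x # r" "snd x \<notin> Y" "\<forall>z\<in>set u. snd z \<in> Y"
    using split_list_first_prop[of w "\<lambda>x. snd x \<notin> Y"] by auto
  have "\<exists>z\<in>set (x # r). snd z \<notin> Y"
    using w by auto
  then obtain v x' u' where r: "x # r = v @ x' # u'" "snd x' \<notin> Y" "\<forall>z\<in>set u'. snd z \<in> Y"
    using split_list_last_prop[of "x # r" "\<lambda>x. snd x \<notin> Y"] by auto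
  show thesis
  proof (rule that)
    show "w = u @ (v @ [x']) @ u'"
      using w r by simp
    show "u \<in> words Y" "u' \<in> words Y"
      using w r by (auto simp: words_iff)
    show "snd (hd (v @ [x'])) \<notin> Y" "snd (last (v @ [x'])) \<notin> Y"
      using w(2) r by (cases v; simp)+
  qed simp
qed

lemma words_hd_last:
  assumes "w \<in> words Y" "w \<noteq> []"
  shows "snd (hd w) \<in> Y" "snd (last w) \<in> Y"
  using assms hd_in_set[of w] last_in_set[of w] by (auto simp: words_iff image_subset_iff)

text \<open>Two words of this kind can be joined without cancellation, so a product of syllables
  from outside and inside \<open>Y\<close> in alternation is cyclically reduced.\<close>

definition syllable_pair :: "'x set \<Rightarrow> 'x word \<Rightarrow> bool" where
  "syllable_pair Y w \<longleftrightarrow> w \<noteq> [] \<and> reduced w \<and> snd (hd w) \<notin> Y \<and> snd (last w) \<in> Y"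

lemma reduced_junction:
  assumes "reduced v" "reduced w" "v \<noteq> []" "w \<noteq> []" "snd (last v) \<noteq> snd (hd w)"
  shows "reduced (v @ w)"
  using assms by (metis letter_inv_simps(2) reduced_append_iff)

lemma syllable_pair_append:
  assumes "syllable_pair Y v" "syllable_pair Y w"
  shows "syllable_pair Y (v @ w)"
proof -
  have "reduced (v @ w)"
    using assms by (intro reduced_junction) (auto simp: syllable_pair_def)
  then show ?thesis
    using assms by (simp add: syllable_pair_def)
qed

lemma syllable_pairI:
  assumes "reduced v" "v \<noteq> []" "snd (hd v) \<notin> Y" "snd (last v) \<notin> Y"
    and "reduced w" "w \<in> words Y" "w \<noteq> []"
  shows "syllable_pair Y (v @ w)"
proof -
  have "reduced (v @ w)"
    using assms words_hd_last[OF assms(6,7)] by (intro reduced_junction) auto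
  then show ?thesis
    using assms words_hd_last[OF assms(6,7)] by (simp add: syllable_pair_def)
qed

text \<open>A word cannot end both in the letter \<open>a\<close> and in the letter
  \<open>b\<close>, so with one of the two there is no cancellation in the conjugate. This is why
  two different letters are interleaved in the rigid word below.\<close>

lemma length_reduce_conj:
  assumes "reduced w" "a \<noteq> b"
  shows "length w \<le> length (reduce (w @ [(True, a)] @ word_inv w)) \<or>
    length w \<le> length (reduce (w @ [(True, b)] @ word_inv w))"
proof (cases "w = []")
  case False
  have "length w \<le> length (reduce (w @ [(True, x)] @ word_inv w))" if x: "snd (last w) \<noteq> x" for x
  proof -
    have "reduced (w @ [(True, x)])"
      using assms(1) False x by (intro reduced_junction) auto
    then have "reduced ((w @ [(True, x)]) @ word_inv w)"
      using assms(1) False x by (intro reduced_junction) (auto simp: hd_last_word_inv)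
    then show ?thesis
      by (simp add: reduce_reduced)
  qed
  from this[of a] this[of b] show ?thesis
    using assms(2) by metis
qed simp

locale rank_four_basis = free_basis G X e for G (structure) and X :: "'x set" and e +
  fixes a b y t :: 'x
  assumes letters: "a \<in> X" "b \<in> X" "y \<in> X" "t \<in> X" and distinct: "distinct [a, b, y, t]"
    and finite_basis: "finite X"
begin

text \<open>\<open>half z = z a z\<^sup>-\<^sup>1 a z b\<close> and \<open>full z = half z
  half(z\<^sup>-\<^sup>1)\<close>. By construction \<open>full(z\<^sup>-\<^sup>1)\<close> is
  conjugate to \<open>full z\<close>. The exponents of \<open>z\<close> alternate in \<open>full
  z\<close>, so only conjugates of \<open>a\<close> and \<open>b\<close> stand between consecutive
  factors \<open>z\<^sup>\<plusminus>\<close>, and these are never trivial. One factor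
  \<open>z\<close> in the first half would not be enough: \<open>z g z\<^sup>-\<^sup>1 g\<close>
  does not change when \<open>z\<close> is multiplied on the right by powers of \<open>g\<close>.
  Therefore \<open>a\<close> and \<open>b\<close> both occur in the positions \<open>z _
  z\<^sup>-\<^sup>1\<close> and in the positions \<open>z\<^sup>-\<^sup>1 _ z\<close>.\<close>

definition half :: "'a \<Rightarrow> 'a" where
  "half z = z \<otimes> (e a \<otimes> (inv z \<otimes> (e a \<otimes> (z \<otimes> e b))))"

definition full :: "'a \<Rightarrow> 'a" where
  "full z = half z \<otimes> half (inv z)"

definition half_word :: "'x word \<Rightarrow> 'x word" where
  "half_word v = v @ (True, a) # word_inv v @ (True, a) # v @ [(True, b)]"

definition core_word :: "'x word" where
  "core_word = half_word [(True, y)] @ half_word [(False, y)]"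

definition core :: 'a where
  "core = full (e y)"

lemma half_closed [simp]: "z \<in> carrier G \<Longrightarrow> half z \<in> carrier G"
  using letters by (simp add: half_def)

lemma full_closed [simp]: "z \<in> carrier G \<Longrightarrow> full z \<in> carrier G"
  by (simp add: full_def)

lemma core_closed [simp]: "core \<in> carrier G"
  using letters by (simp add: core_def)

lemma hom_half:
  assumes "\<phi> \<in> hom G G" "\<phi> (e a) = e a" "\<phi> (e b) = e b" "z \<in> carrier G"
  shows "\<phi> (half z) = half (\<phi> z)"
proof -
  interpret \<phi>: group_hom G G \<phi>
    using assms(1) by unfold_locales
  show ?thesis
    using assms letters by (simp add: half_def)
qed

lemma hom_full:
  assumes "\<phi> \<in> hom G G" "\<phi> (e a) = e a" "\<phi> (e b) = e b" "z \<in> carrier G"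
  shows "\<phi> (full z) = full (\<phi> z)"
proof -
  interpret \<phi>: group_hom G G \<phi>
    using assms(1) by unfold_locales
  show ?thesis
    using assms by (simp add: full_def hom_half)
qed

lemma core_word_props:
  "core_word \<in> words X" "core_word \<in> words (X - {t})" "reduced (core_word @ core_word)"
  "core_word \<noteq> []" "length core_word = 12" "val core_word = core"
  using letters distinct
  by (auto simp: core_word_def half_word_def core_def full_def half_def m_assoc)

lemma core_word_primitive:
  assumes "0 < m" "m < length core_word"
  shows "rotate m core_word \<noteq> core_word"
proof -
  \<comment> \<open>Only the rotations by 4 and 8 preserve the positions of the letters \<open>y\<close> and their signs.\<close>
  have "m = 1 \<or> m = 2 \<or> m = 3 \<or> m = 4 \<or> m = 5 \<or> m = 6 \<or> m = 7 \<or> m = 8 \<or> m = 9 \<or> m = 10 \<or> m = 11"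
    using assms core_word_props(5) by presburger
  then show ?thesis
    using distinct
    by (elim disjE) (simp_all add: core_word_def half_word_def numeral_eq_Suc)
qed

lemma core_pow_neq_one: "0 < k \<Longrightarrow> core [^] (k::nat) \<noteq> \<one>"
  using indep[of "concat (replicate k core_word)"] core_word_props
  by (auto simp: val_power power_in_words reduced_power)

lemma core_centralizer:
  assumes "0 < k" "g \<in> carrier G" "g \<otimes> core [^] (k::nat) = core [^] k \<otimes> g"
  shows "g \<in> generate G {core}"
  using centralizer_of_primitive[of core_word k g] core_word_props core_word_primitive assms by simp

lemma finite_bounded_length: "finite {z \<in> carrier G. length (red z) \<le> k}"
proof -
  have "finite {w :: 'x word. set w \<subseteq> UNIV \<times> X \<and> length w \<le> k}"
    using finite_basis by (intro finite_lists_length_le) simp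
  moreover have "red ` {z \<in> carrier G. length (red z) \<le> k}
      \<subseteq> {w. set w \<subseteq> UNIV \<times> X \<and> length w \<le> k}"
    using red_props(1) by (fastforce simp: words_iff image_subset_iff)
  moreover have "inj_on red {z \<in> carrier G. length (red z) \<le> k}"
    by (rule inj_on_inverseI[of _ val]) simp
  ultimately show ?thesis
    by (meson finite_imageD finite_subset)
qed

text \<open>The retraction that kills \<open>y\<close> fixes \<open>z\<close>. It would therefore
  conjugate \<open>core\<close>, through \<open>full z\<close>, to \<open>full \<one> = a a b a a
  b\<close>, which is too short.\<close>

lemma full_conj_core_not_in_subgroup:
  assumes z: "z \<in> val ` words {a, b}" and k: "k \<in> carrier G" "full z = k \<otimes> core \<otimes> inv k"
  shows False
proof -
  have ab: "{a, b} \<subseteq> X" "y \<notin> {a, b}"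
    using letters distinct by auto
  obtain w where w: "w \<in> words {a, b}" "z = val w"
    using z by auto
  have zG: "z \<in> carrier G"
    using w words_mono[OF w(1) ab(1)] by simp
  let ?f = "\<lambda>x. if x = y then \<one> else e x"
  have f: "?f \<in> X \<rightarrow> carrier G"
    by auto
  define \<phi> where "\<phi> = lift G ?f"
  have \<phi>: "\<phi> \<in> hom G G" and \<phi>_e: "\<And>x. x \<in> X \<Longrightarrow> \<phi> (e x) = ?f x"
    using lift_hom[OF is_group f] lift_basis[OF is_group f] by (auto simp: \<phi>_def)
  interpret \<phi>: group_hom G G \<phi>
    using \<phi> by unfold_locales
  have "\<phi> z = word_val G ?f w"
    using lift_val[OF is_group f words_mono[OF w(1) ab(1)]] w by (simp add: \<phi>_def)
  also have "\<dots> = z"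
    unfolding w(2) by (rule word_val_cong[OF _ w(1)]) (use ab in auto)
  finally have "\<phi> (full z) = full z"
    using \<phi>_e letters distinct zG by (simp add: hom_full \<phi>)
  moreover have "\<phi> core = full \<one>"
    using \<phi>_e letters distinct by (simp add: core_def hom_full \<phi>)
  ultimately have eq: "full z = \<phi> k \<otimes> full \<one> \<otimes> inv (\<phi> k)"
    using k by simp
  have "core = inv k \<otimes> (k \<otimes> core \<otimes> inv k) \<otimes> k"
    using k by (simp add: m_assoc)
  also have "\<dots> = (inv k \<otimes> \<phi> k) \<otimes> full \<one> \<otimes> inv (inv k \<otimes> \<phi> k)"
    using k(1) by (simp add: k(2)[symmetric] eq m_assoc inv_mult_group)
  also have "full \<one> = val [(True, a), (True, a), (True, b), (True, a), (True, a), (True, b)]"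
    using letters by (simp add: full_def half_def m_assoc)
  finally have "length core_word
      \<le> length [(True, a), (True, a), (True, b), (True, a), (True, a), (True, b)]"
    using core_word_props letters k(1)
    by (intro length_cyclically_reduced_le[of core_word _ "inv k \<otimes> \<phi> k"]) auto
  then show False
    by (simp add: core_word_props)
qed

text \<open>The rigidity statement. Write \<open>z = p v q\<close> with \<open>p\<close> and
  \<open>q\<close> in the subgroup generated by \<open>a\<close> and \<open>b\<close> and as long
  as possible. Up to conjugation by \<open>p\<close>, \<open>full z\<close> is the cyclically
  reduced product of six factors \<open>v\<^sup>\<plusminus>\<close> and of six conjugates of
  \<open>a\<close> and \<open>b\<close>, by \<open>q\<close> and by
  \<open>p\<^sup>-\<^sup>1\<close>. Being conjugate to \<open>core\<close>, it has length at most
  12, so all twelve pieces are single letters.\<close>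

lemma length_red_of_full_conj_core:
  assumes z: "z \<in> carrier G" and k: "k \<in> carrier G" "full z = k \<otimes> core \<otimes> inv k"
  shows "length (red z) \<le> 3"
proof -
  let ?Y = "{a, b}"
  have YX: "?Y \<subseteq> X" and ab: "a \<noteq> b"
    using letters distinct by auto
  have "red z \<notin> words ?Y"
    using full_conj_core_not_in_subgroup[OF _ k] z red_props(3)[OF z] by (metis image_eqI)
  then obtain p v q where zw: "red z = p @ v @ q" and pq: "p \<in> words ?Y" "q \<in> words ?Y"
    and v: "v \<noteq> []" "snd (hd v) \<notin> ?Y" "snd (last v) \<notin> ?Y"
    by (rule split_at_outer_letters)
  note pqX = words_mono[OF pq(1) YX] words_mono[OF pq(2) YX]
  have vX: "v \<in> words X"
    using red_props(1)[OF z] zw by simp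
  have red: "reduced p" "reduced v" "reduced q"
    using red_props(2)[OF z] zw by (auto simp: reduced_append_iff)
  define c where "c w x = reduce (w @ [(True, x)] @ word_inv w)" for w and x :: 'x
  have c: "c w x \<in> words ?Y \<and> reduced (c w x) \<and> c w x \<noteq> [] \<and> c w x \<in> words X \<and>
      val (c w x) = val w \<otimes> (e x \<otimes> inv (val w))"
    if "w \<in> words ?Y" "x \<in> ?Y" for w x
  proof -
    have wX: "w \<in> words X" "x \<in> X"
      using words_mono[OF that(1) YX] that(2) YX by auto
    have val: "val (c w x) = val w \<otimes> (e x \<otimes> inv (val w))"
      using wX by (simp add: c_def word_val_reduce[OF basis_closed] val_append val_word_inv)
    have cY: "c w x \<in> words ?Y"
      unfolding c_def by (rule reduce_in_words) (use that in auto)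
    have "c w x \<noteq> []"
    proof
      assume "c w x = []"
      then have "val w \<otimes> (e x \<otimes> inv (val w)) = \<one>"
        using val by simp
      then have "e x = inv (val w) \<otimes> \<one> \<otimes> val w"
        using wX by (metis m_assoc mult_cancel_left(2) inv_closed val_closed basis_in_carrier l_inv r_one m_closed)
      then have "val [(True, x)] = \<one>"
        using wX by simp
      then show False
        using indep[of "[(True, x)]"] wX by simp
    qed
    then show ?thesis
      using val cY words_mono[OF cY YX] by (simp add: c_def reduced_reduce)
  qed
  let ?p = "word_inv p" and ?v = "word_inv v"
  have p: "?p \<in> words ?Y"
    using pq by simp
  define W where "W = (v @ c q a) @ (?v @ c ?p a) @ (v @ c q b) @ (?v @ c ?p a) @ (v @ c q a) @ (?v @ c ?p b)"
  have pair: "syllable_pair ?Y (v @ c w x)" "syllable_pair ?Y (?v @ c w x)"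
    if "w \<in> words ?Y" "x \<in> ?Y" for w x
    using c[OF that] v red by (auto intro!: syllable_pairI simp: hd_last_word_inv)
  have "syllable_pair ?Y W"
    unfolding W_def by (intro syllable_pair_append pair pq p) auto
  then have "reduced (W @ W)"
    using syllable_pair_append by (metis syllable_pair_def)
  moreover have WX: "W \<in> words X"
    using c[OF pq(2)] c[OF p] vX by (simp add: W_def)
  moreover have "val W = (inv (val p) \<otimes> k) \<otimes> val core_word \<otimes> inv (inv (val p) \<otimes> k)"
  proof -
    have "z = val p \<otimes> (val v \<otimes> val q)"
      using red_props(3)[OF z] zw vX pqX by (simp add: val_append)
    then have "val W = inv (val p) \<otimes> full z \<otimes> val p"
      using c[OF pq(2)] c[OF p] vX pqX letters
      by (simp add: W_def val_append val_word_inv full_def half_def inv_mult_group m_assoc)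
    then show ?thesis
      using k pqX by (simp add: core_word_props inv_mult_group m_assoc)
  qed
  ultimately have "length W \<le> 12"
    using length_cyclically_reduced_le[of W core_word "inv (val p) \<otimes> k"] core_word_props k pqX by simp
  moreover have pos: "1 \<le> length v" "1 \<le> length (c q a)" "1 \<le> length (c q b)"
      "1 \<le> length (c ?p a)" "1 \<le> length (c ?p b)"
    using c[OF pq(2)] c[OF p] v(1) by (simp_all add: Suc_le_eq)
  ultimately have "length v \<le> 1 \<and> length (c q a) \<le> 1 \<and> length (c q b) \<le> 1 \<and>
      length (c ?p a) \<le> 1 \<and> length (c ?p b) \<le> 1"
    by (simp add: W_def)
  moreover have "length q \<le> length (c q a) \<or> length q \<le> length (c q b)"
    using length_reduce_conj[OF red(3) ab] by (simp add: c_def)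
  moreover have "length ?p \<le> length (c ?p a) \<or> length ?p \<le> length (c ?p b)"
    using length_reduce_conj[of ?p, OF _ ab] red(1) unfolding c_def by simp
  ultimately show ?thesis
    by (auto simp: zw)
qed


section \<open>The subgroups and the automorphisms\<close>

text \<open>With \<open>t\<close> the basis element \<open>e t\<close>, the group is the
  HNN-extension of \<open>vertex_group\<close> with \<open>core\<^sup>t = edge\<close>. The
  element \<open>edge\<close> carries the information about \<open>y\<close> that is left in
  \<open>fixed_group\<close>.\<close>

definition edge :: 'a where
  "edge = inv (e t) \<otimes> core \<otimes> e t"

definition vertex_group :: "'a set" where
  "vertex_group = generate G (insert edge (e ` (X - {t})))"

definition fixed_group :: "'a set" where
  "fixed_group = generate G (insert edge (e ` (X - {y, t})))"

lemma edge_closed [simp]: "edge \<in> carrier G"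
  using letters by (simp add: edge_def)

lemma subgroup_vertex: "subgroup vertex_group G" and subgroup_fixed: "subgroup fixed_group G"
  unfolding vertex_group_def fixed_group_def by (intro generate_is_subgroup; auto)+

lemma conj_generate_core:
  assumes S: "subgroup S G" "edge \<in> S" and g: "g \<in> generate G {core}"
  shows "inv (e t) \<otimes> g \<otimes> e t \<in> S"
proof -
  have "inv (e t) \<otimes> g \<otimes> e t \<in> generate G {edge}"
    using generate_conj[of "e t" core] letters g by (simp add: edge_def)
  then show ?thesis
    using generate_subgroup_incl[of "{edge}" S] S by auto
qed

lemma core_others: "core \<in> others t"
  using core_word_props(2,6) unfolding others_def by (metis imageI)

lemma half_others: "z \<in> others t \<Longrightarrow> half z \<in> others t"
  using letters distinct by (auto simp: half_def)

lemma core_int_pow_others: "core [^] (i::int) \<in> others t"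
  using subgroup_int_pow_closed[OF others_subgroup core_others] .

text \<open>These automorphisms fix \<open>vertex_group\<close> pointwise and move everything else
  through an infinite orbit.\<close>

definition dehn_twist :: "int \<Rightarrow> 'a \<Rightarrow> 'a" where
  "dehn_twist i = lift G (\<lambda>x. if x = t then core [^] i \<otimes> e t else e x)"

text \<open>Inverting \<open>y\<close> turns \<open>core = half(y) half(y\<^sup>-\<^sup>1)\<close>
  into \<open>half(y\<^sup>-\<^sup>1) half(y)\<close>, its conjugate by \<open>half(y)\<close>.
  The image of \<open>t\<close> is chosen to compensate for this, so that \<open>edge\<close> is
  fixed.\<close>

definition flip :: "'a \<Rightarrow> 'a" where
  "flip = lift G (\<lambda>x. if x = y then inv (e y) else if x = t then inv (half (e y)) \<otimes> e t else e x)"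

lemma dehn_twist_hom: "dehn_twist i \<in> hom G G"
  and dehn_twist_basis: "x \<in> X \<Longrightarrow> dehn_twist i (e x) = (if x = t then core [^] i \<otimes> e t else e x)"
  unfolding dehn_twist_def using letters by (intro lift_hom lift_basis is_group; auto)+

lemma flip_hom: "flip \<in> hom G G"
  and flip_basis: "x \<in> X \<Longrightarrow> flip (e x) =
    (if x = y then inv (e y) else if x = t then inv (half (e y)) \<otimes> e t else e x)"
  unfolding flip_def using letters by (intro lift_hom lift_basis is_group; auto)+

lemma hom_id_on_others:
  assumes "\<phi> \<in> hom G G" "\<And>x. x \<in> X \<Longrightarrow> x \<noteq> s \<Longrightarrow> \<phi> (e x) = e x" "g \<in> others s"
  shows "\<phi> g = g"
proof -
  obtain w where w: "w \<in> words (X - {s})" "g = val w"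
    using assms(3) by (auto simp: others_def)
  have "\<phi> g = word_val G (\<phi> \<circ> e) w"
    unfolding w(2) using w(1) basis_closed
    by (intro word_val_hom[OF is_group assms(1), of _ "X - {s}"]) auto
  also have "\<dots> = g"
    unfolding w(2) by (rule word_val_cong[OF _ w(1)]) (use assms(2) in auto)
  finally show ?thesis .
qed

lemma hom_id_on_generate:
  assumes "\<phi> \<in> hom G G" "S \<subseteq> carrier G" "\<And>g. g \<in> S \<Longrightarrow> \<phi> g = g" "g \<in> generate G S"
  shows "\<phi> g = g"
proof -
  interpret \<phi>: group_hom G G \<phi>
    using assms(1) by unfold_locales
  show ?thesis
    using assms(4)
  proof (induction rule: generate.induct)
    case (eng h1 h2)
    then show ?case
      using generate_in_carrier[OF assms(2)] by simp
  qed (use assms(2,3) in auto)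
qed

lemma dehn_twist_others: "g \<in> others t \<Longrightarrow> dehn_twist i g = g"
  by (rule hom_id_on_others[OF dehn_twist_hom]) (simp_all add: dehn_twist_basis)

lemma dehn_twist_add:
  assumes "g \<in> carrier G"
  shows "dehn_twist i (dehn_twist j g) = dehn_twist (i + j) g"
proof -
  interpret \<phi>: group_hom G G "dehn_twist i"
    using dehn_twist_hom by unfold_locales
  have "(dehn_twist i \<circ> dehn_twist j) g = dehn_twist (i + j) g"
  proof (rule hom_eqI[OF is_group _ dehn_twist_hom _ assms])
    show "dehn_twist i \<circ> dehn_twist j \<in> hom G G"
      using dehn_twist_hom by (auto simp: hom_def Pi_iff)
    fix x assume x: "x \<in> X"
    have "core [^] j \<otimes> (core [^] i \<otimes> e t) = core [^] (i + j) \<otimes> e t"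
      using int_pow_mult[of core j i] letters by (simp add: m_assoc[symmetric] add.commute)
    then show "(dehn_twist i \<circ> dehn_twist j) (e x) = dehn_twist (i + j) (e x)"
      using x letters by (simp add: dehn_twist_basis dehn_twist_others core_int_pow_others)
  qed
  then show ?thesis by simp
qed

lemma dehn_twist_zero: "g \<in> carrier G \<Longrightarrow> dehn_twist 0 g = g"
  using hom_eqI[OF is_group dehn_twist_hom, of id 0 g] letters
  by (auto simp: dehn_twist_basis hom_def)

lemma dehn_twist_iso: "dehn_twist i \<in> iso G G"
  by (rule automorphismI[OF dehn_twist_hom dehn_twist_hom[of "- i"]])
    (simp_all add: dehn_twist_add dehn_twist_zero)

lemma dehn_twist_edge: "dehn_twist i edge = edge"
proof -
  interpret \<phi>: group_hom G G "dehn_twist i"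
    using dehn_twist_hom by unfold_locales
  have "inv (core [^] i) \<otimes> (core \<otimes> core [^] i) = core"
    using int_pow_mult[of core 1 i] int_pow_mult[of core i 1] by (simp add: add.commute)
  then have "inv (core [^] i) \<otimes> (core \<otimes> (core [^] i \<otimes> e t)) = core \<otimes> e t"
    using letters by (simp add: m_assoc[symmetric])
  then show ?thesis
    using letters
    by (simp add: edge_def dehn_twist_basis dehn_twist_others core_others inv_mult_group m_assoc)
qed

lemma dehn_twist_vertex_group:
  assumes "g \<in> vertex_group"
  shows "dehn_twist i g = g"
  using assms unfolding vertex_group_def
  by (rule hom_id_on_generate[OF dehn_twist_hom, rotated 2])
    (auto simp: dehn_twist_edge dehn_twist_basis split: if_splits)

text \<open>A syllable between \<open>t\<^sup>-\<^sup>1\<close> and \<open>t\<close> of a fixed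
  point commutes with a power of \<open>core\<close>. Hence it is a power of \<open>core\<close>,
  and its conjugate by \<open>t\<close> is a power of \<open>edge\<close>.\<close>

lemma dehn_twist_fixed_points:
  assumes k: "0 < k" and g: "g \<in> carrier G" "dehn_twist (int k) g = g"
  shows "g \<in> vertex_group"
proof -
  let ?q = "core [^] k"
  have q: "?q \<in> others t" "?q \<noteq> \<one>"
    using core_int_pow_others[of "int k"] core_pow_neq_one[OF k] by (simp_all add: int_pow_int)
  interpret basis_twist G X e t "dehn_twist (int k)" ?q
    using letters q by unfold_locales
      (simp_all add: dehn_twist_hom dehn_twist_others dehn_twist_basis int_pow_int)
  show ?thesis
  proof (rule fixed_points_subset[OF subgroup_vertex _ _ _ _ g])
    fix g assume g: "g \<in> others t"
    then have gG: "g \<in> carrier G" by simp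
    obtain w where w: "w \<in> words (X - {t})" "g = val w"
      using g by (auto simp: others_def)
    show "g \<in> vertex_group"
      unfolding w(2) using w(1)
      by (intro word_val_in_subgroup[OF subgroup_vertex]) (auto simp: vertex_group_def generate.incl)
    show "dehn_twist (int k) g \<otimes> ?q \<noteq> g" "inv ?q \<otimes> dehn_twist (int k) g \<noteq> g"
      using g q gG by (simp_all add: dehn_twist_others)
    assume "inv ?q \<otimes> (dehn_twist (int k) g \<otimes> ?q) = g"
    then have "g \<otimes> ?q = ?q \<otimes> g"
      using g gG by (metis dehn_twist_others inv_solve_left' m_closed nat_pow_closed core_closed)
    then have "g \<in> generate G {core}"
      using core_centralizer[OF k gG] by simp
    then show "inv (e t) \<otimes> g \<otimes> e t \<in> vertex_group"
      by (intro conj_generate_core[OF subgroup_vertex]) (simp_all add: vertex_group_def generate.incl)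
  qed
qed

text \<open>An element of the algebraic closure has a finite orbit under the twists, so some
  non-trivial twist fixes it.\<close>

lemma acl_subset_vertex_group: "acl G fixed_group \<subseteq> vertex_group"
proof
  fix g assume g: "g \<in> acl G fixed_group"
  have gG: "g \<in> carrier G"
    using g by (auto simp: acl_def solutions_def)
  have sub: "fixed_group \<subseteq> vertex_group"
    unfolding fixed_group_def vertex_group_def by (rule mono_generate) auto
  have "finite (range (\<lambda>i. dehn_twist i g))"
    using sub dehn_twist_vertex_group
    by (intro acl_finite_orbit[OF is_group subgroup.subset[OF subgroup_fixed] g dehn_twist_iso]) auto
  then have "\<not> inj (\<lambda>i. dehn_twist i g)"
    by (metis finite_imageD infinite_UNIV_int)
  then obtain i j where ij: "dehn_twist i g = dehn_twist j g" "i < j"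
    unfolding inj_def by (metis linorder_neqE_linordered_idom)
  have "dehn_twist (- i) (dehn_twist i g) = dehn_twist (- i) (dehn_twist j g)"
    by (simp add: ij(1))
  then have "dehn_twist (int (nat (j - i))) g = g"
    using gG ij(2) by (simp add: dehn_twist_add dehn_twist_zero)
  then show "g \<in> vertex_group"
    using ij(2) gG by (intro dehn_twist_fixed_points[of "nat (j - i)"]) auto
qed

lemma flip_core: "flip core = half (inv (e y)) \<otimes> half (e y)"
  and flip_half: "flip (half (e y)) = half (inv (e y))"
proof -
  interpret \<phi>: group_hom G G flip
    using flip_hom by unfold_locales
  have *: "flip (e a) = e a" "flip (e b) = e b" "flip (e y) = inv (e y)"
    using letters distinct by (auto simp: flip_basis)
  show "flip (half (e y)) = half (inv (e y))"
    using * letters by (simp add: hom_half[OF flip_hom])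
  show "flip core = half (inv (e y)) \<otimes> half (e y)"
    using * letters by (simp add: core_def full_def hom_half[OF flip_hom])
qed

lemma flip_edge: "flip edge = edge"
proof -
  interpret \<phi>: group_hom G G flip
    using flip_hom by unfold_locales
  have "flip (e t) = inv (half (e y)) \<otimes> e t"
    using letters distinct by (auto simp: flip_basis)
  then show ?thesis
    using letters
    by (simp add: edge_def flip_core inv_mult_group m_assoc) (simp add: core_def full_def m_assoc)
qed

lemma flip_fixed_group:
  assumes "g \<in> fixed_group"
  shows "flip g = g"
  using assms unfolding fixed_group_def
  by (rule hom_id_on_generate[OF flip_hom, rotated 2]) (auto simp: flip_edge flip_basis split: if_splits)

lemma flip_iso: "flip \<in> iso G G"
proof -
  let ?f = "\<lambda>x. if x = y then inv (e y) else if x = t then half (inv (e y)) \<otimes> e t else e x"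
  \<comment> \<open>The inverse has to multiply \<open>t\<close> by \<open>flip (half (e y))\<close>.\<close>
  define flop where "flop = lift G ?f"
  have f: "?f \<in> X \<rightarrow> carrier G"
    using letters by auto
  have flop: "flop \<in> hom G G" and flop_basis: "\<And>x. x \<in> X \<Longrightarrow> flop (e x) = ?f x"
    using lift_hom[OF is_group f] lift_basis[OF is_group f] by (auto simp: flop_def)
  interpret \<phi>: group_hom G G flip
    using flip_hom by unfold_locales
  interpret \<psi>: group_hom G G flop
    using flop by unfold_locales
  have "flip (half (inv (e y))) = half (e y)" "flop (half (e y)) = half (inv (e y))"
    using letters distinct
    by (simp_all add: hom_half[OF flip_hom] hom_half[OF flop] flip_basis flop_basis)
  then show ?thesis
    using letters distinct
    by (intro automorphismI[OF flip_hom flop]) (auto simp: flip_basis flop_basis)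
qed

lemma flip_others:
  assumes "g \<in> others t"
  shows "flip g \<in> others t" "flip (flip g) = g" "flip g = g \<Longrightarrow> g \<in> fixed_group"
proof -
  interpret \<phi>: group_hom G G flip
    using flip_hom by unfold_locales
  obtain w where w: "w \<in> words (X - {t})" "reduced w" "g = val w"
    using assms red_others[OF assms] by (metis others_closed red_props(2,3))
  define r where "r = map (\<lambda>(c, x). (if x = y then \<not> c else c, x))"
  \<comment> \<open>The map acts on words without the letter \<open>t\<close> letter by letter, hence on reduced words.\<close>
  have r: "r v \<in> words (X - {t}) \<and> val (r v) = flip (val v)" if "v \<in> words (X - {t})" for v
    using that
  proof (induction v)
    case (Cons l v)
    obtain c x where l: "l = (c, x)" by fastforce
    have "v \<in> words X"
      using Cons.prems words_mono[of v "X - {t}" X] by auto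
    then show ?case
      using Cons l letters by (auto simp: r_def flip_basis)
  qed (simp add: r_def)
  show "flip g \<in> others t"
    using r[OF w(1)] w(3) unfolding others_def by (metis imageI)
  have "r (r v) = v" for v
    by (induction v) (auto simp: r_def split: if_splits)
  then show "flip (flip g) = g"
    using r[OF w(1)] r[of "r w"] w(3) by simp
  assume fix_g: "flip g = g"
  have "reduced (r v) \<longleftrightarrow> reduced v" for v
    by (induction v rule: induct_list012) (auto simp: r_def split: if_splits)
  then have "r w = w"
    using r[OF w(1)] w fix_g words_mono[of _ "X - {t}" X] by (intro reduced_unique) auto
  then have "\<forall>l\<in>set w. snd l \<noteq> y"
    by (induction w) (auto simp: r_def split: if_splits)
  then have "w \<in> words (X - {y, t})"
    using w(1) by (auto simp: words_iff)
  then show "g \<in> fixed_group"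
    unfolding w(3)
    by (intro word_val_in_subgroup[OF subgroup_fixed]) (auto simp: fixed_group_def generate.incl)
qed

text \<open>On the free factor without \<open>t\<close> the map \<open>flip\<close> is an
  involution. Applying it to each of the equations for the syllables of a fixed point and
  combining the result with the equation itself turns \<open>half (e y)\<close> into
  \<open>core\<close>: two of the equations give \<open>core = \<one>\<close>, and the third one
  says that a syllable commutes with \<open>core\<close>.\<close>

lemma flip_fixed_points:
  assumes g: "g \<in> carrier G" "flip g = g"
  shows "g \<in> fixed_group"
proof -
  let ?p = "half (e y)" and ?p' = "half (inv (e y))"
  interpret \<phi>: group_hom G G flip
    using flip_hom by unfold_locales
  have p: "?p \<in> carrier G" "?p' \<in> carrier G" "?p \<in> others t"
    using letters distinct by (auto intro!: half_others)
  have pp: "?p \<otimes> ?p' = core"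
    by (simp add: core_def full_def)
  have core1: "core \<noteq> \<one>"
    using core_pow_neq_one[of 1] by simp
  have ker: "h = \<one>" if "h \<in> others t" "flip h = \<one>" for h
    using flip_others(2)[OF that(1)] that(2) by simp
  interpret basis_twist G X e t flip "inv ?p"
    by unfold_locales
      (use letters p distinct in \<open>auto simp: flip_hom flip_basis intro: flip_others(1) ker\<close>)
  show ?thesis
  proof (rule fixed_points_subset[OF subgroup_fixed _ _ _ _ g])
    fix g assume g: "g \<in> others t"
    then have gG: "g \<in> carrier G" and fG: "flip g \<in> carrier G" by auto
    show "g \<in> fixed_group" if "flip g = g"
      using flip_others(3)[OF g that] .
    show "flip g \<otimes> inv ?p \<noteq> g"
    proof
      assume "flip g \<otimes> inv ?p = g"
      then have "g \<otimes> ?p = flip g \<otimes> inv ?p \<otimes> ?p"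
        by simp
      then have fg: "flip g = g \<otimes> ?p"
        using fG p by (simp add: m_assoc)
      have "g = flip (g \<otimes> ?p)"
        using flip_others(2)[OF g] by (simp only: fg)
      also have "\<dots> = g \<otimes> ?p \<otimes> ?p'"
        using gG p by (simp add: flip_half fg)
      also have "\<dots> = g \<otimes> core"
        using gG p by (simp add: m_assoc pp)
      finally show False
        using core1 gG by simp
    qed
    show "inv (inv ?p) \<otimes> flip g \<noteq> g"
    proof
      assume "inv (inv ?p) \<otimes> flip g = g"
      then have fg: "?p \<otimes> flip g = g"
        using p by simp
      have "flip (?p \<otimes> flip g) = ?p' \<otimes> g"
        using fG p by (simp add: flip_half flip_others(2)[OF g])
      then have "?p' \<otimes> g = flip g"
        by (simp only: fg)
      then have "core \<otimes> g = g"
        using fg gG p by (simp add: pp[symmetric] m_assoc)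
      then show False
        using core1 gG by simp
    qed
    assume "inv (inv ?p) \<otimes> (flip g \<otimes> inv ?p) = g"
    then have fg: "?p \<otimes> (flip g \<otimes> inv ?p) = g"
      using p by simp
    have "flip (?p \<otimes> (flip g \<otimes> inv ?p)) = ?p' \<otimes> (g \<otimes> inv ?p')"
      using fG p by (simp add: flip_half flip_others(2)[OF g])
    then have "flip g = ?p' \<otimes> (g \<otimes> inv ?p')"
      unfolding fg .
    then have "?p \<otimes> (?p' \<otimes> (g \<otimes> inv ?p') \<otimes> inv ?p) = g"
      using fg by simp
    moreover have "?p \<otimes> (?p' \<otimes> (g \<otimes> inv ?p') \<otimes> inv ?p) = core \<otimes> g \<otimes> inv core"
      using gG p by (simp add: pp[symmetric] m_assoc inv_mult_group)
    ultimately have "core \<otimes> g \<otimes> inv core \<otimes> core = g \<otimes> core"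
      by simp
    then have "g \<otimes> core = core \<otimes> g"
      using gG by (simp add: m_assoc)
    then have "g \<in> generate G {core}"
      using core_centralizer[of 1 g] gG by simp
    then show "inv (e t) \<otimes> g \<otimes> e t \<in> fixed_group"
      by (intro conj_generate_core[OF subgroup_fixed]) (simp_all add: fixed_group_def generate.incl)
  qed
qed

lemma dcl_fixed_group: "dcl G fixed_group = fixed_group"
proof
  show "fixed_group \<subseteq> dcl G fixed_group"
    using subgroup.subset[OF subgroup_fixed] by (rule subset_dcl)
  show "dcl G fixed_group \<subseteq> fixed_group"
  proof
    fix g assume g: "g \<in> dcl G fixed_group"
    then have "g \<in> carrier G"
      by (auto simp: dcl_def solutions_def)
    moreover have "flip g = g"
      using dcl_fixed[OF is_group flip_iso subgroup.subset[OF subgroup_fixed] _ g] flip_fixed_group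
      by simp
    ultimately show "g \<in> fixed_group"
      by (rule flip_fixed_points)
  qed
qed

lemma fixed_group_proper: "fixed_group \<subset> vertex_group"
proof -
  have "e y \<in> vertex_group"
    using letters distinct by (auto simp: vertex_group_def intro: generate.incl)
  moreover have "flip (e y) \<noteq> e y"
  proof
    assume "flip (e y) = e y"
    then have "val [(False, y)] = val [(True, y)]"
      using letters by (simp add: flip_basis)
    then show False
      using reduced_unique[of "[(False, y)]" "[(True, y)]"] letters by simp
  qed
  ultimately have "e y \<in> vertex_group - fixed_group"
    using flip_fixed_group by auto
  moreover have "fixed_group \<subseteq> vertex_group"
    unfolding fixed_group_def vertex_group_def by (rule mono_generate) auto
  ultimately show ?thesis by auto
qed

definition half_term :: "'a gterm \<Rightarrow> 'a gterm" where
  "half_term z = Mult z (Mult (Param (e a)) (Mult (Inv z) (Mult (Param (e a)) (Mult z (Param (e b))))))"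

text \<open>The formula \<open>\<exists>x\<^sub>2. x\<^sub>2\<^sup>-\<^sup>1 full(x\<^sub>1) x\<^sub>2 = edge\<close>,
  over \<open>fixed_group\<close>.\<close>

definition conj_formula :: "'a gformula" where
  "conj_formula = Neg (All 2 (Neg (Eq
    (Mult (Inv (Var 2)) (Mult (Mult (half_term (Var 1)) (half_term (Inv (Var 1)))) (Var 2)))
    (Param edge))))"

lemma sat_conj_formula:
  "sat G (\<lambda>_. z) conj_formula \<longleftrightarrow> (\<exists>h\<in>carrier G. inv h \<otimes> (full z \<otimes> h) = edge)"
  by (simp add: conj_formula_def half_term_def full_def half_def)

text \<open>By rigidity the formula has finitely many solutions, and \<open>y\<close> is one of
  them.\<close>

lemma vertex_group_subset_acl: "vertex_group \<subseteq> acl G fixed_group"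
proof -
  have fG: "fixed_group \<subseteq> carrier G"
    using subgroup_fixed by (rule subgroup.subset)
  have incl: "e a \<in> fixed_group" "e b \<in> fixed_group" "edge \<in> fixed_group"
    using letters distinct by (auto simp: fixed_group_def intro: generate.incl)
  have "generate G (insert (e y) fixed_group) \<subseteq> acl G fixed_group"
  proof (rule generate_insert_subset_acl[OF is_group fG, of conj_formula])
    show "fm_params conj_formula \<subseteq> fixed_group" "free_vars conj_formula \<subseteq> {1}"
      using incl by (auto simp: conj_formula_def half_term_def)
    show "e y \<in> carrier G"
      using letters by simp
    have "inv (e t) \<otimes> (full (e y) \<otimes> e t) = edge"
      using letters by (simp add: edge_def core_def m_assoc)
    then show "sat G (\<lambda>_. e y) conj_formula"
      using letters by (auto simp: sat_conj_formula)
    have "length (red z) \<le> 3" if z: "z \<in> carrier G" "sat G (\<lambda>_. z) conj_formula" for z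
    proof -
      obtain h where h: "h \<in> carrier G" "inv h \<otimes> (full z \<otimes> h) = edge"
        using z by (auto simp: sat_conj_formula)
      have "full z = h \<otimes> (inv h \<otimes> (full z \<otimes> h)) \<otimes> inv h"
        using h(1) that(1) by (simp add: m_assoc)
      also have "\<dots> = (h \<otimes> inv (e t)) \<otimes> core \<otimes> inv (h \<otimes> inv (e t))"
        using h letters by (simp add: edge_def m_assoc inv_mult_group)
      finally show ?thesis
        using that(1) h(1) letters by (intro length_red_of_full_conj_core) auto
    qed
    then show "finite {z \<in> carrier G. sat G (\<lambda>_. z) conj_formula}"
      using finite_subset[OF _ finite_bounded_length[of 3]] by (simp add: subset_iff)
  qed
  moreover have "vertex_group \<subseteq> generate G (insert (e y) fixed_group)"
    unfolding vertex_group_def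
  proof (rule mono_generate)
    show "insert edge (e ` (X - {t})) \<subseteq> insert (e y) fixed_group"
      using incl by (auto simp: fixed_group_def intro: generate.incl)
  qed
  ultimately show ?thesis by auto
qed

end

theorem theorem1p4:
  fixes \<Gamma> :: "('a, 'b) monoid_scheme" and n :: nat
  assumes "free_of_rank \<Gamma> n" and "n \<ge> 4"
  shows "\<exists>H t u v A. is_hnn_extension \<Gamma> H t u v \<and>
           subgroup A \<Gamma> \<and> A \<subset> H \<and> acl \<Gamma> A = H \<and> dcl \<Gamma> A = A"
proof -
  obtain e where "free_basis \<Gamma> {..<n} e"
    using assms(1) by (rule free_of_rank_basis)
  then interpret free_basis \<Gamma> "{..<n}" e .
  interpret rank_four_basis \<Gamma> "{..<n}" e 0 1 2 3
    using assms(2) by unfold_locales auto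
  have "is_hnn_extension \<Gamma> vertex_group (e 3) core edge"
    unfolding edge_def vertex_group_def by (rule hnn_extension_of_basis[OF letters(4) core_others])
  then show ?thesis
    using subgroup_fixed fixed_group_proper dcl_fixed_group
      acl_subset_vertex_group vertex_group_subset_acl by blast
qed

end
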